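(* Let $p(n)$ denote the number of integer partitions of $n$, and let $\nu(n)$ denote the number of partitions of $n$ having no part equal to $1$. Then, as $n\to\infty$, $$p(n)\ \sim\ \nu(n)\sqrt{\frac{n}{\zeta(2)}},$$ where $\zeta(2)=\pi^2/6$.
   Context: A partition with no part equal to $1$ is called a non-unitary partition. $f(n)\sim g(n)$ means $f(n)/g(n)\to 1$. *)

theory Defs
  imports "HOL-Analysis.Analysis" "HOL-Library.Multiset" "HOL-Library.Landau_Symbols"
begin

definition partitions_of :: "nat \<Rightarrow> nat multiset set" where
  "partitions_of n = {M. (\<forall>k\<in>#M. 0 < k) \<and> sum_mset M = n}"

definition part_count :: "nat \<Rightarrow> nat" where
  "part_count n = card (partitions_of n)"

definition nonunitary_part_count :: "nat \<Rightarrow> nat" where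
  "nonunitary_part_count n = card {M \<in> partitions_of n. 1 \<notin># M}"

end

theory Submission
  imports Defs "HOL-Probability.Sinc_Integral"
begin

text \<open>
  Circle method with a single saddle point. The generating function of the partitions is
  \<open>P z = exp (L z)\<close> with \<open>L z = (\<Sum>m\<ge>1. z ^ m / (m * (1 - z ^ m)))\<close>. Since
  \<open>\<nu>(n) = p(n) - p(n - 1)\<close>, both \<open>p(n)\<close> and \<open>\<nu>(n)\<close> are integrals over the circle of radius
  \<open>exp (-t)\<close> of \<open>P z * z powi (-n)\<close>, the latter with the extra factor \<open>1 - z\<close>. Choose
  \<open>t = sqrt (\<zeta>(2) / n)\<close> and put \<open>z = exp (-t + \<i> * x)\<close>, \<open>x = s * t powr (3/2)\<close>. After division by
  \<open>P (exp (-t)) * exp (n * t)\<close> the integrand of \<open>p(n)\<close> converges to \<open>exp (- \<zeta>(2) * s\<^sup>2)\<close>, because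
  \<open>L (exp (-w)) - \<zeta>(2) / w\<close> varies by \<open>o(1)\<close> on this scale. The first term of the series \<open>L\<close>
  alone yields an integrable majorant in \<open>s\<close>. As \<open>(1 - z) / t\<close> tends to \<open>1\<close>, dominated convergence
  gives \<open>\<nu>(n) / (t * p(n)) \<longrightarrow> 1\<close>, with no need for the Hardy-Ramanujan asymptotics.
\<close>

subsection \<open>Partitions with bounded parts\<close>

text \<open>A bound on the parts makes the generating function a finite product, so coefficients
  come from a recursion on \<open>N\<close>; afterwards \<open>N\<close> tends to infinity.\<close>

definition bounded_part_count :: "nat \<Rightarrow> nat \<Rightarrow> nat" where
  "bounded_part_count N n = card {M. set_mset M \<subseteq> {1..N} \<and> sum_mset M = n}"

lemma finite_partitions_of: "finite (partitions_of n)"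
proof -
  have "partitions_of n \<subseteq> mset ` {xs. set xs \<subseteq> {..n} \<and> length xs \<le> n}"
  proof
    fix M assume M: "M \<in> partitions_of n"
    obtain xs where xs: "mset xs = M" using ex_mset by blast
    have pos: "\<forall>k\<in>set xs. 0 < k" and s: "sum_list xs = n"
      using M xs by (auto simp: partitions_of_def sum_mset_sum_list)
    have "set xs \<subseteq> {..n}" using s member_le_sum_list by fastforce
    moreover have "length xs \<le> sum_list xs" using pos by (induction xs) auto
    ultimately show "M \<in> mset ` {xs. set xs \<subseteq> {..n} \<and> length xs \<le> n}"
      using xs s by auto
  qed
  then show ?thesis by (rule finite_surj[rotated]) (intro finite_lists_length_le finite_atMost)
qed

lemma finite_bounded_partitions:
  "finite {M. set_mset M \<subseteq> {1..N} \<and> sum_mset M = (n::nat)}"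
  by (rule finite_subset[OF _ finite_partitions_of[of n]]) (auto simp: partitions_of_def)

lemma bounded_part_count_0: "bounded_part_count 0 n = (if n = 0 then 1 else 0)"
proof -
  have "{M. set_mset M \<subseteq> {1..0} \<and> sum_mset M = n} = (if n = 0 then {{#}} else {})"
    by auto
  then show ?thesis by (simp add: bounded_part_count_def)
qed

text \<open>Removing one copy of \<open>Suc N\<close> is a bijection on the partitions that contain
  this part. This is the combinatorial form of the new factor
  \<open>1 / (1 - z ^ Suc N)\<close>.\<close>

lemma bounded_part_count_Suc:
  "bounded_part_count (Suc N) n =
     bounded_part_count N n + (if Suc N \<le> n then bounded_part_count (Suc N) (n - Suc N) else 0)"
proof -
  define A where "A N n = {M. set_mset M \<subseteq> {1..N} \<and> sum_mset M = n}" for N n :: nat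
  define B where "B = {M \<in> A (Suc N) n. Suc N \<in># M}"
  have fin: "finite (A N n)" for N n unfolding A_def by (rule finite_bounded_partitions)
  have split: "A (Suc N) n = A N n \<union> B"
    by (auto simp: A_def B_def subset_iff le_Suc_eq)
  have disj: "A N n \<inter> B = {}" by (force simp: A_def B_def)
  have add: "add_mset (Suc N) M \<in> A (Suc N) n \<longleftrightarrow> Suc N \<le> n \<and> M \<in> A (Suc N) (n - Suc N)" for M
    by (auto simp: A_def)
  have B_iff: "M \<in> B \<longleftrightarrow> (\<exists>M'\<in>A (Suc N) (n - Suc N). M = add_mset (Suc N) M') \<and> Suc N \<le> n" for M
  proof
    assume M: "M \<in> B"
    then obtain M' where "M = add_mset (Suc N) M'" unfolding B_def by (auto dest: multi_member_split)
    then show "(\<exists>M'\<in>A (Suc N) (n - Suc N). M = add_mset (Suc N) M') \<and> Suc N \<le> n"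
      using M add unfolding B_def by blast
  next
    assume "(\<exists>M'\<in>A (Suc N) (n - Suc N). M = add_mset (Suc N) M') \<and> Suc N \<le> n"
    then show "M \<in> B" using add unfolding B_def by fastforce
  qed
  have "card B = (if Suc N \<le> n then card (A (Suc N) (n - Suc N)) else 0)"
  proof (cases "Suc N \<le> n")
    case True
    then have "B = add_mset (Suc N) ` A (Suc N) (n - Suc N)" using B_iff by blast
    then show ?thesis using True by (simp add: card_image inj_on_def)
  next
    case False
    then have "B = {}" using B_iff by blast
    then show ?thesis using False by simp
  qed
  moreover have "card (A (Suc N) n) = card (A N n) + card B"
    unfolding split by (rule card_Un_disjoint) (use disj fin in \<open>simp_all add: B_def\<close>)
  ultimately show ?thesis by (simp add: bounded_part_count_def A_def)
qed

lemma part_count_eq_bounded: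
  assumes "n \<le> N"
  shows "part_count n = bounded_part_count N n"
proof -
  have "k \<le> N" if k: "k \<in># M" "sum_mset M = n" for k M
  proof -
    obtain M' where "M = add_mset k M'" using multi_member_split[OF k(1)] by blast
    then show ?thesis using k assms by auto
  qed
  then have "partitions_of n = {M. set_mset M \<subseteq> {1..N} \<and> sum_mset M = n}"
    by (auto simp: partitions_of_def Suc_le_eq)
  then show ?thesis by (simp add: part_count_def bounded_part_count_def)
qed

text \<open>Deleting a single part 1 is a bijection from the partitions of \<open>Suc n\<close> that
  contain 1 to all partitions of \<open>n\<close>.\<close>

lemma part_count_Suc: "part_count (Suc n) = nonunitary_part_count (Suc n) + part_count n"
proof -
  let ?U = "{M \<in> partitions_of (Suc n). 1 \<notin># M}"
  have "M \<in> add_mset 1 ` partitions_of n" if "M \<in> partitions_of (Suc n)" "1 \<in># M" for M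
  proof -
    from that obtain M' where M': "M = add_mset 1 M'" by (auto dest: multi_member_split)
    then show ?thesis using that by (auto simp: partitions_of_def)
  qed
  then have "partitions_of (Suc n) = ?U \<union> add_mset 1 ` partitions_of n"
    by (auto simp: partitions_of_def)
  moreover have "card (?U \<union> add_mset 1 ` partitions_of n) = card ?U + card (add_mset 1 ` partitions_of n)"
    by (rule card_Un_disjoint) (auto simp: finite_partitions_of)
  moreover have "card (add_mset 1 ` partitions_of n) = card (partitions_of n)"
    by (rule card_image) (auto simp: inj_on_def)
  ultimately show ?thesis by (simp add: part_count_def nonunitary_part_count_def)
qed

subsection \<open>Coefficient extraction\<close>

lemma has_integral_cis_int:
  fixes m :: int
  shows "((\<lambda>x. cis (of_int m * x)) has_integral (if m = 0 then of_real (2 * pi) else 0)) {-pi..pi}"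
proof (cases "m = 0")
  case True
  then show ?thesis using has_integral_const_real[of "1::complex" "-pi" pi]
    by (simp add: scaleR_conv_of_real)
next
  case False
  let ?F = "\<lambda>x. cis (of_int m * x) / (\<i> * of_int m)"
  have "((\<lambda>x. cis (of_int m * x)) has_integral ?F pi - ?F (-pi)) {-pi..pi}"
  proof (rule fundamental_theorem_of_calculus)
    fix x :: real
    have "((\<lambda>w. exp (\<i> * of_int m * w) / (\<i> * of_int m)) has_field_derivative
        exp (\<i> * of_int m * of_real x)) (at (of_real x))"
      using False by (auto intro!: derivative_eq_intros)
    then have "((\<lambda>x. exp (\<i> * of_int m * of_real x) / (\<i> * of_int m)) has_vector_derivative
        exp (\<i> * of_int m * of_real x)) (at x within {-pi..pi})"
      by (rule has_vector_derivative_real_field)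
    then show "(?F has_vector_derivative cis (of_int m * x)) (at x within {-pi..pi})"
      by (simp add: cis_conv_exp mult_ac)
  qed auto
  moreover have "cis (of_int m * pi) = cis (of_int m * (-pi))"
    by (simp add: complex_eq_iff sin_integer_2pi sin_zero_iff_int2) 
  ultimately show ?thesis using False by simp
qed

lemma one_minus_power_nonzero:
  fixes z :: complex
  assumes "norm z < 1" "k > 0"
  shows "1 - z ^ k \<noteq> 0"
proof
  assume "1 - z ^ k = 0"
  then have "norm z ^ k = 1" by (metis eq_iff_diff_eq_0 norm_one norm_power)
  then show False using assms power_less_one_iff[of "norm z" k] by auto
qed

lemma partition_product_continuous:
  assumes "0 < q" "q < 1"
  shows "continuous_on S (\<lambda>x. (\<Prod>k=1..N. 1 / (1 - (complex_of_real q * cis x) ^ k)) *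
           (complex_of_real q * cis x) powi j)"
  using assms
  by (intro continuous_intros ballI one_minus_power_nonzero) (auto simp: norm_mult)

text \<open>Induction on \<open>N\<close>: the integrals obey the same recursion as the counts.
  Letting \<open>j\<close> range over all integers supplies the start of that recursion, since the
  integrals vanish for negative \<open>j\<close>.\<close>

lemma bounded_part_count_integral:
  assumes q: "0 < q" "q < 1"
  shows "integral {-pi..pi} (\<lambda>x. (\<Prod>k=1..N. 1 / (1 - (complex_of_real q * cis x) ^ k)) *
           (complex_of_real q * cis x) powi (-j)) =
         of_real (2 * pi * (if 0 \<le> j then real (bounded_part_count N (nat j)) else 0))"
proof (induction N arbitrary: j)
  case 0
  have "integral {-pi..pi} (\<lambda>x. (complex_of_real q * cis x) powi (-j)) =
        integral {-pi..pi} (\<lambda>x. of_real q powi (-j) * cis (of_int (-j) * x))"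
    by (simp add: power_int_mult_distrib cis_power_int)
  also have "\<dots> = of_real q powi (-j) * (if j = 0 then of_real (2 * pi) else 0)"
    using has_integral_cis_int[of "-j"] by (simp add: integral_unique)
  also have "\<dots> = of_real (2 * pi * (if 0 \<le> j then real (bounded_part_count 0 (nat j)) else 0))"
    by (auto simp: bounded_part_count_0)
  finally show ?case by simp
next
  case (Suc N)
  define z where "z x = complex_of_real q * cis x" for x
  define A where "A N x = (\<Prod>k=1..N. 1 / (1 - z x ^ k))" for N x
  define I where "I j = integral {-pi..pi} (\<lambda>x. A (Suc N) x * z x powi (-j))" for j
  define J where "J j = integral {-pi..pi} (\<lambda>x. A N x * z x powi (-j))" for j
  have nz: "z x \<noteq> 0" "norm (z x) = q" for x using q by (auto simp: z_def norm_mult)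
  have cont: "continuous_on {-pi..pi} (\<lambda>x. A M x * z x powi j)" for M j
    unfolding A_def z_def using partition_product_continuous[OF q] .
  \<comment> \<open>Multiplication by \<open>1 - z ^ Suc N\<close> cancels the last factor of the
    product, and a power of \<open>z\<close> only shifts the index \<open>j\<close>.\<close>
  have step: "I j = J j + I (j - int (Suc N))" for j
  proof -
    have "A (Suc N) x * z x powi (-j) - A (Suc N) x * z x powi (-(j - int (Suc N))) =
          A N x * z x powi (-j)" for x
    proof -
      have "z x powi (-(j - int (Suc N))) = z x powi (-j) * z x ^ Suc N"
        using nz(1)[of x] power_int_add[of "z x" "-j" "int (Suc N)"]
        by (simp del: power_Suc of_nat_Suc)
      moreover have "A (Suc N) x = A N x / (1 - z x ^ Suc N)"
        by (simp add: A_def)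
      then have "A N x = A (Suc N) x * (1 - z x ^ Suc N)"
        using one_minus_power_nonzero[of "z x" "Suc N"] nz q by simp
      ultimately show ?thesis by (simp only: right_diff_distrib mult_1_right mult_1_left left_diff_distrib mult_ac)
    qed
    then have "J j = I j - I (j - int (Suc N))"
      unfolding I_def J_def
      by (subst integral_diff[symmetric]) (auto intro!: integrable_continuous_real cont)
    then show ?thesis by simp
  qed
  have J: "J j = of_real (2 * pi * (if 0 \<le> j then real (bounded_part_count N (nat j)) else 0))" for j
    using Suc.IH[of j] by (simp add: J_def A_def z_def)
  \<comment> \<open>At negative indices \<open>J\<close> vanishes, so \<open>I\<close> does not
    change when \<open>j\<close> drops by a multiple of \<open>Suc N\<close>. Each drop multiplies
    the integrand by \<open>z ^ Suc N\<close>, of modulus \<open>q ^ Suc N < 1\<close>, so the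
    common value must be 0.\<close>
  have neg: "I j = 0" if "j < 0" for j
  proof -
    have iter: "I j = I (j - int (k * Suc N))" for k
    proof (induction k)
      case (Suc k)
      have "I (j - int (k * Suc N)) = J (j - int (k * Suc N)) + I (j - int (k * Suc N) - int (Suc N))"
        by (rule step)
      also have "J (j - int (k * Suc N)) = 0"
      proof -
        have "j - int (k * Suc N) < 0" using that by linarith
        then show ?thesis unfolding J by simp
      qed
      also have "j - int (k * Suc N) - int (Suc N) = j - int (Suc k * Suc N)" by (simp add: algebra_simps)
      finally show ?case using Suc by simp
    qed simp
    have "bounded ((\<lambda>x. A (Suc N) x * z x powi (-j)) ` {-pi..pi})"
      by (intro compact_imp_bounded compact_continuous_image cont) auto
    then obtain B where B: "\<And>x. x \<in> {-pi..pi} \<Longrightarrow> norm (A (Suc N) x * z x powi (-j)) \<le> B"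
      unfolding bounded_iff by blast
    have "norm (I j) \<le> B * (q ^ Suc N) ^ k * (2 * pi)" for k
    proof -
      have "norm (I (j - int (k * Suc N))) \<le> B * (q ^ Suc N) ^ k * (pi - (-pi))"
        unfolding I_def
      proof (rule integral_bound)
        fix x assume x: "x \<in> {-pi..pi}"
        have "z x powi (-(j - int (k * Suc N))) = z x powi (-j) * z x ^ (k * Suc N)"
          using nz(1)[of x] power_int_add[of "z x" "-j" "int (k * Suc N)"]
          by (simp del: power_Suc of_nat_Suc of_nat_mult mult_Suc_right)
        then have "norm (A (Suc N) x * z x powi (-(j - int (k * Suc N)))) =
            norm (A (Suc N) x * z x powi (-j)) * q ^ (k * Suc N)"
          by (simp add: norm_mult norm_power nz del: mult_Suc_right)
        also have "\<dots> \<le> B * q ^ (k * Suc N)" using B[OF x] q by (intro mult_right_mono) auto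
        also have "q ^ (k * Suc N) = (q ^ Suc N) ^ k"
          by (metis mult.commute power_mult)
        finally show "norm (A (Suc N) x * z x powi (-(j - int (k * Suc N)))) \<le> B * (q ^ Suc N) ^ k" .
      qed (use cont in auto)
      then show ?thesis using iter[of k] by simp
    qed
    moreover have "(\<lambda>k. B * (q ^ Suc N) ^ k * (2 * pi)) \<longlonglongrightarrow> B * 0 * (2 * pi)"
      using q by (intro tendsto_intros LIMSEQ_power_zero) (auto simp: power_less_one_iff simp del: power_Suc)
    ultimately have "norm (I j) \<le> B * 0 * (2 * pi)"
      by (intro LIMSEQ_le_const) blast+
    then show ?thesis by simp
  qed
  have "I (int n) = of_real (2 * pi * real (bounded_part_count (Suc N) n))" for n
  proof (induction n rule: less_induct)
    case (less n)
    have I: "I (int n) = of_real (2 * pi * bounded_part_count N n) + I (int n - int (Suc N))"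
      using step[of "int n"] by (simp add: J)
    show ?case
    proof (cases "Suc N \<le> n")
      case True
      then have "int n - int (Suc N) = int (n - Suc N)" by simp
      then show ?thesis using I less.IH[of "n - Suc N"] True
        by (simp add: bounded_part_count_Suc[of N n] algebra_simps del: of_nat_Suc)
    next
      case False
      then show ?thesis using I neg[of "int n - int (Suc N)"]
        by (simp add: bounded_part_count_Suc[of N n])
    qed
  qed
  from this[of "nat j"] neg[of j] have "I j = of_real (2 * pi * (if 0 \<le> j then real (bounded_part_count (Suc N) (nat j)) else 0))"
    by (cases "j \<ge> 0") auto
  then show ?case by (simp add: I_def A_def z_def)
qed

subsection \<open>The logarithm of the generating function\<close>

text \<open>A Lambert series: expand each \<open>- ln (1 - z ^ k)\<close> in powers of
  \<open>z ^ k\<close> and sum over \<open>k\<close> first. It provides a logarithm of the infinite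
  product without a choice of branch.\<close>

definition partition_log :: "complex \<Rightarrow> complex" where
  "partition_log z = (\<Sum>m. z ^ Suc m / (of_nat (Suc m) * (1 - z ^ Suc m)))"

lemma one_minus_norm_le:
  fixes z :: complex
  assumes "norm z < 1"
  shows "1 - norm z \<le> norm (1 - z ^ Suc m)"
proof -
  have "norm z ^ Suc m \<le> norm z" using assms by (simp add: mult_left_le power_le_one)
  moreover have "1 - norm (z ^ Suc m) \<le> norm (1 - z ^ Suc m)"
    using norm_triangle_ineq2[of 1 "z ^ Suc m"] by simp
  ultimately show ?thesis by (simp add: norm_power norm_mult)
qed

lemma norm_geometric_term_le:
  fixes z :: complex
  assumes "norm z < 1"
  shows "norm (z ^ Suc m / (of_nat (Suc m) * (1 - z ^ Suc m))) \<le> norm z ^ Suc m / (1 - norm z)"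
proof -
  have "1 * (1 - norm z) \<le> real (Suc m) * norm (1 - z ^ Suc m)"
    using one_minus_norm_le[OF assms, of m] assms by (intro mult_mono) auto
  then show ?thesis unfolding norm_divide norm_mult norm_of_nat norm_power
    using assms by (intro divide_left_mono) (auto intro: mult_pos_pos)
qed

lemma summable_norm_power:
  fixes z :: complex
  assumes "norm z < 1"
  shows "summable (\<lambda>m. c * (norm z ^ Suc m / (1 - norm z)))"
proof -
  have "summable (\<lambda>m. norm z ^ Suc m)"
    using summable_geometric[of "norm z"] assms by (subst summable_Suc_iff) simp
  then show ?thesis by (intro summable_mult summable_divide)
qed

lemma summable_partition_log:
  assumes "norm z < 1"
  shows "summable (\<lambda>m. z ^ Suc m / (of_nat (Suc m) * (1 - z ^ Suc m)) :: complex)"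
  by (rule summable_comparison_test'[OF summable_norm_power[OF assms, of 1]])
     (simp only: mult_1 norm_geometric_term_le[OF assms])

text \<open>Only finitely many logarithmic series are added, so summing over \<open>k\<close> inside
  is harmless and gives a finite geometric sum. The cutoff \<open>N\<close> then survives only in
  the factor \<open>1 - (z ^ Suc m) ^ N\<close>, which suits a termwise limit.\<close>

lemma partition_product_eq_exp:
  fixes z :: complex
  assumes "norm z < 1"
  shows "(\<Prod>k=1..N. 1 / (1 - z ^ k)) =
    exp (\<Sum>m. z ^ Suc m / (of_nat (Suc m) * (1 - z ^ Suc m)) * (1 - (z ^ Suc m) ^ N))"
proof -
  have ln: "(\<lambda>m. w ^ Suc m / of_nat (Suc m)) sums (- ln (1 - w))" if "norm w < 1" for w :: complex
  proof -
    have "(\<lambda>n. - (w ^ n) / of_nat n) sums ln (1 - w)" using Ln_series'[of "-w"] that by simp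
    then have "(\<lambda>n. w ^ n / of_nat n) sums (- ln (1 - w))" by (drule_tac sums_minus) simp
    then show ?thesis by (subst sums_Suc_iff) simp
  qed
  have lt: "norm (z ^ k) < 1" if "k \<in> {1..N}" for k
    using assms that by (auto simp: norm_power power_less_one_iff)
  have "(\<lambda>m. \<Sum>k=1..N. (z ^ k) ^ Suc m / of_nat (Suc m)) sums (\<Sum>k=1..N. - ln (1 - z ^ k))"
    by (intro sums_sum ln lt)
  also have "(\<lambda>m. \<Sum>k=1..N. (z ^ k) ^ Suc m / of_nat (Suc m)) =
      (\<lambda>m. z ^ Suc m / (of_nat (Suc m) * (1 - z ^ Suc m)) * (1 - (z ^ Suc m) ^ N))"
  proof
    fix m
    define w where "w = z ^ Suc m"
    have w: "1 - w \<noteq> 0" unfolding w_def using assms by (intro one_minus_power_nonzero) auto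
    have "(\<Sum>k=1..N. (z ^ k) ^ Suc m) = (\<Sum>k=1..N. w ^ k)"
      unfolding w_def by (intro sum.cong refl) (metis power_commutes power_mult mult.commute)
    also have "\<dots> = w * (1 - w ^ N) / (1 - w)"
    proof -
      have "(\<Sum>k=1..N. w ^ k) * (1 - w) = w * (1 - w ^ N)"
      proof (induction N)
        case (Suc N)
        have "(\<Sum>k=1..Suc N. w ^ k) * (1 - w) = (\<Sum>k=1..N. w ^ k) * (1 - w) + w ^ Suc N * (1 - w)"
          by (simp add: distrib_right)
        also have "\<dots> = w * (1 - w ^ Suc N)" unfolding Suc by (simp add: algebra_simps)
        finally show ?case .
      qed simp
      then show ?thesis using w by (simp add: field_simps)
    qed
    finally show "(\<Sum>k=1..N. (z ^ k) ^ Suc m / of_nat (Suc m)) =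
        z ^ Suc m / (of_nat (Suc m) * (1 - z ^ Suc m)) * (1 - (z ^ Suc m) ^ N)"
      unfolding w_def[symmetric] sum_divide_distrib[symmetric] by (simp add: field_simps)
  qed
  finally have "(\<Sum>m. z ^ Suc m / (of_nat (Suc m) * (1 - z ^ Suc m)) * (1 - (z ^ Suc m) ^ N)) =
      (\<Sum>k=1..N. - ln (1 - z ^ k))"
    by (rule sums_unique[symmetric])
  moreover have "exp (\<Sum>k=1..N. - ln (1 - z ^ k)) = (\<Prod>k=1..N. 1 / (1 - z ^ k))"
  proof -
    have "1 - z ^ k \<noteq> 0" if "k \<in> {1..N}" for k
      using one_minus_power_nonzero[OF assms, of k] that by simp
    then show ?thesis
      by (subst exp_sum) (auto intro!: prod.cong simp: exp_minus exp_Ln inverse_eq_divide)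
  qed
  ultimately show ?thesis by simp
qed

lemma norm_truncated_term_le:
  fixes z :: complex
  assumes "norm z < 1"
  shows "norm (z ^ Suc m / (of_nat (Suc m) * (1 - z ^ Suc m)) * (1 - (z ^ Suc m) ^ N))
    \<le> 2 * (norm z ^ Suc m / (1 - norm z))"
proof -
  have "norm (1 - (z ^ Suc m) ^ N) \<le> 1 + norm ((z ^ Suc m) ^ N)"
    using norm_triangle_ineq4[of 1 "(z ^ Suc m) ^ N"] by simp
  also have "norm ((z ^ Suc m) ^ N) \<le> 1"
    unfolding norm_power using assms by (intro power_le_one) auto
  finally have "norm (1 - (z ^ Suc m) ^ N) \<le> 2" by simp
  then have "norm (z ^ Suc m / (of_nat (Suc m) * (1 - z ^ Suc m))) * norm (1 - (z ^ Suc m) ^ N) \<le>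
      (norm z ^ Suc m / (1 - norm z)) * 2"
    using assms by (intro mult_mono norm_geometric_term_le) auto
  then show ?thesis by (simp only: norm_mult mult.commute)
qed

text \<open>The bound depends on \<open>norm z\<close> alone, so on a fixed circle it is a constant
  majorant, uniform in \<open>N\<close>.\<close>

lemma norm_partition_product_le:
  fixes z :: complex
  assumes "norm z < 1"
  shows "norm (\<Prod>k=1..N. 1 / (1 - z ^ k)) \<le> exp (\<Sum>m. 2 * (norm z ^ Suc m / (1 - norm z)))"
proof -
  have "norm (\<Sum>m. z ^ Suc m / (of_nat (Suc m) * (1 - z ^ Suc m)) * (1 - (z ^ Suc m) ^ N)) \<le>
      (\<Sum>m. 2 * (norm z ^ Suc m / (1 - norm z)))"
    by (rule norm_suminf_le) (intro summable_norm_power norm_truncated_term_le assms)+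
  then show ?thesis
    unfolding partition_product_eq_exp[OF assms]
    by (intro order_trans[OF norm_exp]) simp
qed

lemma partition_product_tendsto:
  fixes z :: complex
  assumes "norm z < 1"
  shows "(\<lambda>N. \<Prod>k=1..N. 1 / (1 - z ^ k)) \<longlonglongrightarrow> exp (partition_log z)"
proof -
  have "(\<lambda>N. \<Sum>m. z ^ Suc m / (of_nat (Suc m) * (1 - z ^ Suc m)) * (1 - (z ^ Suc m) ^ N))
      \<longlonglongrightarrow> partition_log z"
    unfolding partition_log_def
  proof (rule conjunct2[OF conjunct2[OF tannerys_theorem]])
    fix m
    have "norm (z ^ Suc m) < 1" using assms
      by (simp add: norm_power power_less_one_iff del: power_Suc)
    then have "(\<lambda>N. z ^ Suc m / (of_nat (Suc m) * (1 - z ^ Suc m)) * (1 - (z ^ Suc m) ^ N)) \<longlonglongrightarrow>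
        z ^ Suc m / (of_nat (Suc m) * (1 - z ^ Suc m)) * (1 - 0)"
      by (intro tendsto_intros LIMSEQ_power_zero)
    then show "(\<lambda>N. z ^ Suc m / (of_nat (Suc m) * (1 - z ^ Suc m)) * (1 - (z ^ Suc m) ^ N)) \<longlonglongrightarrow>
        z ^ Suc m / (of_nat (Suc m) * (1 - z ^ Suc m))" by simp
  next
    show "\<forall>\<^sub>F (m, N) in sequentially \<times>\<^sub>F sequentially.
      norm (z ^ Suc m / (of_nat (Suc m) * (1 - z ^ Suc m)) * (1 - (z ^ Suc m) ^ N))
      \<le> 2 * (norm z ^ Suc m / (1 - norm z))"
      by (intro always_eventually) (use norm_truncated_term_le[OF assms] in auto)
  qed (use summable_norm_power[OF assms] in auto)
  then show ?thesis
    unfolding partition_product_eq_exp[OF assms] by (rule tendsto_exp)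
qed

text \<open>Passage to the limit in \<open>bounded_part_count_integral\<close>: the truncated
  integrands converge boundedly on the circle, while their integrals no longer change once
  \<open>N\<close> reaches \<open>n\<close>.\<close>

lemma part_count_has_integral:
  assumes q: "0 < q" "q < 1"
  shows "((\<lambda>x. exp (partition_log (complex_of_real q * cis x)) * (complex_of_real q * cis x) powi (- int n))
    has_integral of_real (2 * pi * real (part_count n))) {-pi..pi}"
proof -
  define z where "z x = complex_of_real q * cis x" for x
  define f where "f N x = (\<Prod>k=1..N. 1 / (1 - z x ^ k)) * z x powi (- int n)" for N x
  define g where "g x = exp (partition_log (z x)) * z x powi (- int n)" for x
  define B where "B = exp (\<Sum>m. 2 * (q ^ Suc m / (1 - q))) * q powi (- int n)"
  have z: "norm (z x) = q" for x using q by (simp add: z_def norm_mult)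
  have 1: "f N integrable_on {-pi..pi}" for N
    unfolding f_def z_def
    by (intro integrable_continuous_real partition_product_continuous q)
  have 2: "norm (f N x) \<le> B" for N x
    using norm_partition_product_le[of "z x" N] q
    unfolding f_def B_def norm_mult norm_power_int z by (intro mult_right_mono) auto
  have 3: "(\<lambda>N. f N x) \<longlonglongrightarrow> g x" for x
    unfolding f_def g_def using z[of x] q by (intro tendsto_intros partition_product_tendsto) auto
  have gi: "g integrable_on {-pi..pi}" and gl: "(\<lambda>N. integral {-pi..pi} (f N)) \<longlonglongrightarrow> integral {-pi..pi} g"
    using dominated_convergence[of f "{-pi..pi}" "\<lambda>_. B" g] 1 2 3 by auto
  have "(\<lambda>N. integral {-pi..pi} (f N)) \<longlonglongrightarrow> of_real (2 * pi * real (part_count n))"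
  proof (rule tendsto_eventually, rule eventually_sequentiallyI[of n])
    fix N assume "n \<le> N"
    then show "integral {-pi..pi} (f N) = of_real (2 * pi * real (part_count n))"
      using bounded_part_count_integral[OF q, of N "int n"] part_count_eq_bounded[of n N]
      by (simp add: f_def[abs_def] z_def)
  qed
  from LIMSEQ_unique[OF gl this] gi
  have "(g has_integral of_real (2 * pi * real (part_count n))) {-pi..pi}"
    by (simp add: has_integral_iff)
  then show ?thesis by (simp only: g_def[abs_def] z_def)
qed

subsection \<open>Decay away from the saddle point\<close>

lemma Re_geometric_le:
  fixes w :: complex
  assumes "norm w < 1"
  shows "Re (w / (1 - w)) \<le> norm w / (1 - norm w)"
proof -
  have "Re (w / (1 - w)) \<le> norm (w / (1 - w))" by (rule complex_Re_le_cmod)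
  also have "\<dots> \<le> norm w / (1 - norm w)"
    unfolding norm_divide using assms norm_triangle_ineq2[of 1 w] by (intro divide_left_mono) (auto intro!: mult_pos_pos)
  finally show ?thesis .
qed

text \<open>Every term of the series has its largest real part, for given modulus, at the positive
  real point. All differences beyond the first are therefore nonpositive and may be dropped.\<close>

lemma Re_partition_log_diff_le:
  assumes "norm z < 1"
  shows "Re (partition_log z) - Re (partition_log (of_real (norm z))) \<le>
    Re (z / (1 - z)) - norm z / (1 - norm z)"
proof -
  define a where "a w m = w ^ Suc m / (of_nat (Suc m) * (1 - w ^ Suc m))" for w :: complex and m
  have sm: "summable (a w)" if "norm w < 1" for w
    unfolding a_def using summable_partition_log[OF that] .
  let ?q = "complex_of_real (norm z)"
  have q: "norm ?q < 1" using assms by simp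
  have sd: "summable (\<lambda>m. Re (a z m - a ?q m))"
    by (intro summable_Re summable_diff sm assms q)
  have "Re (partition_log z) - Re (partition_log ?q) = (\<Sum>m. Re (a z m - a ?q m))"
    unfolding partition_log_def a_def[symmetric]
    using sm[OF assms] sm[OF q] by (simp add: Re_suminf suminf_diff summable_Re)
  also have "\<dots> = Re (a z 0 - a ?q 0) + (\<Sum>m. Re (a z (Suc m) - a ?q (Suc m)))"
    using suminf_split_head[OF sd] by simp
  also have "(\<Sum>m. Re (a z (Suc m) - a ?q (Suc m))) \<le> 0"
  proof (rule suminf_le_const)
    show "summable (\<lambda>m. Re (a z (Suc m) - a ?q (Suc m)))"
      using sd by (subst summable_Suc_iff)
    have "Re (a z k - a ?q k) \<le> 0" for k
    proof -
      define w where "w = z ^ Suc k"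
      have w: "norm w < 1" unfolding w_def norm_power using assms by (simp add: power_less_one_iff del: power_Suc)
      have "a z k = w / (1 - w) / of_nat (Suc k)"
        by (simp add: a_def w_def)
      then have "Re (a z k) = Re (w / (1 - w)) / Suc k" by (simp only: Re_divide_of_nat)
      moreover have "?q ^ Suc k = of_real (norm w)" by (simp add: w_def norm_power norm_mult)
      then have "a ?q k = of_real (norm w / (1 - norm w) / Suc k)"
        by (simp only: a_def) simp
      then have "Re (a ?q k) = norm w / (1 - norm w) / Suc k" by (simp only: Re_complex_of_real)
      ultimately show ?thesis using divide_right_mono[OF Re_geometric_le[OF w], of "real (Suc k)"] by simp
    qed
    then show "(\<Sum>m<n. Re (a z (Suc m) - a ?q (Suc m))) \<le> 0" for n
      by (intro sum_nonpos) auto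
  qed
  also have "Re (a z 0 - a ?q 0) = Re (z / (1 - z)) - norm z / (1 - norm z)"
  proof -
    have "a ?q 0 = of_real (norm z / (1 - norm z))" by (simp add: a_def)
    then show ?thesis by (simp add: a_def)
  qed
  finally show ?thesis by simp
qed

text \<open>The second factor of the denominator is the squared modulus of
  \<open>1 - q * cis x\<close>. Everything is expressed through \<open>1 - cos x\<close>, for which
  a quadratic lower bound is available.\<close>

lemma Re_geometric_diff:
  assumes "0 < q" "q < 1"
  shows "q / (1 - q) - Re (complex_of_real q * cis x / (1 - complex_of_real q * cis x)) =
    q * (1 + q) * (1 - cos x) / ((1 - q) * ((1 - q)\<^sup>2 + 2 * q * (1 - cos x)))"
proof -
  define w where "w = 1 - cos x"
  define D where "D = (1 - q)\<^sup>2 + 2 * q * w"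
  have D: "D > 0" unfolding D_def w_def using assms by (intro add_pos_nonneg) auto
  have "Re (complex_of_real q * cis x / (1 - complex_of_real q * cis x)) =
     (q * cos x * (1 - q * cos x) - q\<^sup>2 * (sin x)\<^sup>2) / ((1 - q * cos x)\<^sup>2 + q\<^sup>2 * (sin x)\<^sup>2)"
    by (simp add: Re_divide power2_eq_square algebra_simps)
  also have "(1 - q * cos x)\<^sup>2 + q\<^sup>2 * (sin x)\<^sup>2 = D"
    unfolding D_def w_def sin_squared_eq by (simp add: power2_eq_square algebra_simps)
  also have "q * cos x * (1 - q * cos x) - q\<^sup>2 * (sin x)\<^sup>2 = q * (1 - w) - q\<^sup>2"
    unfolding w_def sin_squared_eq by (simp add: power2_eq_square algebra_simps)
  also have "q / (1 - q) - (q * (1 - w) - q\<^sup>2) / D = q * (1 + q) * w / ((1 - q) * D)"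
  proof -
    have "q * D - (q * (1 - w) - q\<^sup>2) * (1 - q) = q * (1 + q) * w"
      unfolding D_def by (simp add: power2_eq_square algebra_simps)
    then show ?thesis using D assms by (simp add: diff_frac_eq)
  qed
  finally show ?thesis by (simp add: D_def w_def)
qed

text \<open>Sine is concave on this interval and so lies above the chord between the
  endpoints.\<close>

lemma Jordan_sin_ge:
  fixes x :: real
  assumes "0 \<le> x" "x \<le> pi / 2"
  shows "2 / pi * x \<le> sin x"
proof -
  have "convex_on {0..pi/2} (\<lambda>x. - sin x)"
  proof (rule f''_ge0_imp_convex)
    show "((\<lambda>x. - sin x) has_real_derivative - cos x) (at x)" for x
      by (auto intro!: derivative_eq_intros)
    show "((\<lambda>x. - cos x) has_real_derivative sin x) (at x)" for x
      by (auto intro!: derivative_eq_intros)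
    show "0 \<le> sin x" if "x \<in> {0..pi/2}" for x using that by (auto intro!: sin_ge_zero)
  qed auto
  from convex_onD[OF this, of "2 / pi * x" 0 "pi / 2"] show ?thesis
    using assms by (simp add: field_simps)
qed

lemma one_minus_cos_ge:
  fixes x :: real
  assumes "\<bar>x\<bar> \<le> pi"
  shows "2 * x\<^sup>2 / pi\<^sup>2 \<le> 1 - cos x"
proof -
  have "2 / pi * (\<bar>x\<bar> / 2) \<le> sin (\<bar>x\<bar> / 2)" using assms by (intro Jordan_sin_ge) auto
  then have "(2 / pi * (\<bar>x\<bar> / 2))\<^sup>2 \<le> (sin (\<bar>x\<bar> / 2))\<^sup>2" by (intro power_mono) auto
  also have "(sin (\<bar>x\<bar> / 2))\<^sup>2 = (1 - cos x) / 2"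
    using cos_double_sin[of "\<bar>x\<bar> / 2"] by simp
  finally show ?thesis by (simp add: power2_eq_square mult_ac)
qed

text \<open>The map from \<open>u\<close> to \<open>u / (t * (t\<^sup>2 + 2 * u))\<close> is
  increasing, so a lower bound for \<open>q * (1 - cos x)\<close> can be inserted; then
  \<open>1 - q \<le> t\<close> shrinks the denominator. The hypothesis \<open>t \<le> 1/2\<close>
  yields \<open>1/2 \<le> q\<close>, which absorbs the 2 in
  \<open>2 * x\<^sup>2 / pi\<^sup>2\<close>.\<close>

lemma norm_partition_ratio_le:
  assumes t: "0 < t" "t \<le> 1/2" and x: "\<bar>x\<bar> \<le> pi"
  shows "norm (exp (partition_log (of_real (exp (-t)) * cis x) - partition_log (of_real (exp (-t))))) \<le>
    exp (- (x\<^sup>2 / (t * (pi\<^sup>2 * t\<^sup>2 + 2 * x\<^sup>2))))"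
proof -
  define q where "q = exp (-t)"
  have q: "0 < q" "q < 1" "1/2 \<le> q" "1 - q \<le> t"
    using t exp_ge_add_one_self[of "-t"] by (auto simp: q_def)
  define w where "w = 1 - cos x"
  have w: "2 * x\<^sup>2 / pi\<^sup>2 \<le> w" "0 \<le> w" unfolding w_def using one_minus_cos_ge[OF x] by auto
  have qw: "x\<^sup>2 / pi\<^sup>2 \<le> q * w"
    using mult_mono[OF q(3) w(1)] q w by simp
  have "x\<^sup>2 / (t * (pi\<^sup>2 * t\<^sup>2 + 2 * x\<^sup>2)) = (x\<^sup>2 / pi\<^sup>2) / (t * (t\<^sup>2 + 2 * (x\<^sup>2 / pi\<^sup>2)))"
    by (simp add: field_simps)
  also have "\<dots> \<le> (q * w) / (t * (t\<^sup>2 + 2 * (q * w)))"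
  proof -
    define u where "u = x\<^sup>2 / pi\<^sup>2"
    have "0 \<le> u" "u \<le> q * w" using qw by (auto simp: u_def)
    then have "u * t\<^sup>2 \<le> q * w * t\<^sup>2" by (intro mult_right_mono) auto
    then have "u * (t * (t\<^sup>2 + 2 * (q * w))) \<le> q * w * (t * (t\<^sup>2 + 2 * u))"
      using t mult_left_mono[of "u * t\<^sup>2" "q * w * t\<^sup>2" t] by (simp add: algebra_simps)
    moreover have pos: "t * (t\<^sup>2 + 2 * u) > 0" "t * (t\<^sup>2 + 2 * (q * w)) > 0"
      using t q w \<open>0 \<le> u\<close> by (auto intro!: mult_pos_pos add_pos_nonneg)
    ultimately show ?thesis unfolding u_def[symmetric]
      by (simp only: pos_divide_le_eq[OF pos(1)] times_divide_eq_left pos_le_divide_eq[OF pos(2)])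
  qed
  also have "\<dots> \<le> (q * w) / ((1 - q) * ((1 - q)\<^sup>2 + 2 * (q * w)))"
    using t q w
    by (intro divide_left_mono mult_mono add_mono power_mono mult_pos_pos add_pos_nonneg) auto
  also have "\<dots> \<le> q * (1 + q) * w / ((1 - q) * ((1 - q)\<^sup>2 + 2 * q * w))"
  proof -
    have "q * w \<le> q * (1 + q) * w" using q w by (simp add: algebra_simps)
    moreover have "0 \<le> (1 - q) * ((1 - q)\<^sup>2 + 2 * q * w)" using q w by (intro mult_nonneg_nonneg) auto
    ultimately show ?thesis by (simp add: divide_right_mono mult.assoc)
  qed
  also have "\<dots> = q / (1 - q) - Re (of_real q * cis x / (1 - of_real q * cis x))"
    using Re_geometric_diff[OF q(1,2), of x] by (simp add: w_def)
  also have "\<dots> \<le> Re (partition_log (of_real q)) - Re (partition_log (of_real q * cis x))"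
    using Re_partition_log_diff_le[of "of_real q * cis x"] q by (simp add: norm_mult)
  finally show ?thesis by (simp add: norm_exp_eq_Re q_def)
qed

text \<open>An integrable majorant uniform in \<open>t\<close>. The true Gaussian decay is lost for
  large \<open>s\<close>, where the exponent is only of order \<open>1 / t\<close>; the constraint
  from \<open>\<bar>x\<bar> \<le> pi\<close> turns this into polynomial decay in \<open>s\<close>.
  The weight \<open>1 + \<bar>s\<bar>\<close> makes room for the factor
  \<open>(1 - z) / t\<close>.\<close>

lemma gaussian_decay_bound:
  fixes s t :: real
  assumes t: "0 < t" and s: "\<bar>s\<bar> * (t * sqrt t) \<le> pi"
  shows "(1 + \<bar>s\<bar>) * exp (- (s\<^sup>2 / (pi\<^sup>2 + 2 * s\<^sup>2 * t))) \<le>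
    (4 + 4 * (6 ^ 6 * 64 * (pi ^ 12 + 64 * pi ^ 4))) * inverse (1 + s\<^sup>2)"
proof (cases "\<bar>s\<bar> \<le> 1")
  case True
  then have s2: "s\<^sup>2 \<le> 1" by (simp add: abs_square_le_1)
  have "(1 + \<bar>s\<bar>) * exp (- (s\<^sup>2 / (pi\<^sup>2 + 2 * s\<^sup>2 * t))) \<le> 2 * 1"
    using True t by (intro mult_mono) (auto intro!: divide_nonneg_nonneg add_nonneg_nonneg)
  also have "\<dots> \<le> 4 * inverse (1 + s\<^sup>2)"
  proof -
    have "1 + s\<^sup>2 > 0" by (intro add_pos_nonneg) auto
    then show ?thesis using s2 by (simp add: field_simps)
  qed
  also have "\<dots> \<le> (4 + 4 * (6 ^ 6 * 64 * (pi ^ 12 + 64 * pi ^ 4))) * inverse (1 + s\<^sup>2)"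
    by (intro mult_right_mono) auto
  finally show ?thesis .
next
  case False
  then have s1: "1 \<le> \<bar>s\<bar>" by simp
  then have s2: "1 \<le> s\<^sup>2" using power_mono[of 1 "\<bar>s\<bar>" 2] by simp
  define C where "C = 6 ^ 6 * 64 * (pi ^ 12 + 64 * pi ^ 4)"
  have C: "C \<ge> 0" by (simp add: C_def)
  define y where "y = s\<^sup>2 / (pi\<^sup>2 + 2 * s\<^sup>2 * t)"
  have y: "y > 0" unfolding y_def using s2 t by (intro divide_pos_pos add_pos_nonneg) auto
  \<comment> \<open>The reciprocal of the exponent splits into a Gaussian part \<open>a\<close> and
    a part \<open>b\<close> that limits the decay.\<close>
  define a where "a = pi\<^sup>2 / s\<^sup>2"
  define b where "b = 2 * t"
  have ab: "1 / y = a + b" "0 \<le> a" "0 \<le> b" using s1 t by (auto simp: y_def a_def b_def field_simps)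
  \<comment> \<open>The sixth power is chosen because \<open>t ^ 6 = (t * sqrt t) ^ 4\<close>, which
    the constraint bounds by a multiple of \<open>1 / s ^ 4\<close>. Against the weight, at most
    \<open>2 * s\<^sup>2\<close>, this still leaves order \<open>1 / s\<^sup>2\<close>.\<close>
  have "y / 6 \<le> exp (y / 6)" using exp_ge_add_one_self[of "y / 6"] by linarith
  then have "(y / 6) ^ 6 \<le> exp (y / 6) ^ 6"
    using y by (intro power_mono) auto
  also have "\<dots> = exp y" by (simp flip: exp_of_nat_mult)
  finally have "exp (-y) \<le> 6 ^ 6 * (1 / y) ^ 6"
    using y by (simp add: exp_minus field_simps)
  also have "(1 / y) ^ 6 \<le> (2 * max a b) ^ 6" unfolding ab using ab by (intro power_mono) auto
  also have "\<dots> = 64 * max a b ^ 6" by (simp add: power_mult_distrib)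
  also have "max a b ^ 6 \<le> a ^ 6 + b ^ 6" using ab by (auto simp: max_def)
  also have "a ^ 6 \<le> pi ^ 12 / s ^ 4"
  proof -
    have "a ^ 6 = pi ^ 12 / (s\<^sup>2) ^ 6" by (simp add: a_def power_divide flip: power_mult)
    also have "\<dots> \<le> pi ^ 12 / (s\<^sup>2) ^ 2"
    proof (rule divide_left_mono)
      show "(s\<^sup>2) ^ 2 \<le> (s\<^sup>2) ^ 6" using s2 by (intro power_increasing) auto
      have "0 < s\<^sup>2" using s2 by linarith
      then show "0 < (s\<^sup>2) ^ 6 * (s\<^sup>2) ^ 2" by (intro mult_pos_pos) (rule zero_less_power, assumption)+
    qed auto
    finally show ?thesis by (simp flip: power_mult)
  qed
  also have "b ^ 6 \<le> 64 * pi ^ 4 / s ^ 4"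
  proof -
    have "(t * sqrt t) ^ 4 = t ^ 4 * ((sqrt t)\<^sup>2) ^ 2" by (simp add: power_mult_distrib flip: power_mult)
    also have "\<dots> = t ^ 6" using t by (simp flip: power_add)
    finally have "t ^ 6 = (t * sqrt t) ^ 4" by simp
    moreover have "t * sqrt t \<le> pi / \<bar>s\<bar>" using s s1 by (simp add: field_simps)
    then have "(t * sqrt t) ^ 4 \<le> (pi / \<bar>s\<bar>) ^ 4" using t by (intro power_mono) auto
    ultimately show ?thesis by (simp add: b_def power_mult_distrib power_divide power_even_abs)
  qed
  finally have e: "exp (-y) \<le> C / s ^ 4"
    by (simp add: C_def add_divide_distrib)
  have "(1 + \<bar>s\<bar>) * exp (-y) \<le> (2 * s\<^sup>2) * (C / s ^ 4)"
  proof (intro mult_mono e)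
    have "\<bar>s\<bar> \<le> s\<^sup>2" using mult_mono[OF s1 order_refl[of "\<bar>s\<bar>"]] by (simp add: power2_eq_square)
    then show "1 + \<bar>s\<bar> \<le> 2 * s\<^sup>2" using s2 by simp
  qed auto
  also have "\<dots> = 2 * C / s\<^sup>2" using s1 by (simp add: field_simps power2_eq_square power4_eq_xxxx)
  also have "\<dots> \<le> 4 * C * inverse (1 + s\<^sup>2)"
  proof -
    have "2 * C * (1 + s\<^sup>2) \<le> 2 * C * (2 * s\<^sup>2)" using s2 C by (intro mult_left_mono) auto
    moreover have "s\<^sup>2 > 0" "1 + s\<^sup>2 > 0" using s2 by linarith+
    ultimately show ?thesis by (simp add: field_simps)
  qed
  also have "\<dots> \<le> (4 + 4 * C) * inverse (1 + s\<^sup>2)" by (intro mult_right_mono) auto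
  finally show ?thesis by (simp only: C_def y_def)
qed

subsection \<open>Behaviour near the saddle point\<close>

lemma norm_exp_minus_one_ge:
  assumes "0 < Re w"
  shows "Re w \<le> norm (exp w - 1)" "exp (Re w) - 1 \<le> norm (exp w - 1)"
proof -
  show *: "exp (Re w) - 1 \<le> norm (exp w - 1)"
    using norm_triangle_ineq2[of "exp w" 1] by (simp add: norm_exp_eq_Re)
  show "Re w \<le> norm (exp w - 1)"
    using exp_ge_add_one_self[of "Re w"] * by linarith
qed

lemma exp_minus_one_nonzero: "0 < Re w \<Longrightarrow> exp w - 1 \<noteq> 0"
  using norm_exp_minus_one_ge(1)[of w] by force

text \<open>After division by \<open>exp x\<close> and a square root this says that \<open>x\<close>
  is at most twice the hyperbolic sine of \<open>x / 2\<close>; the difference has derivative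
  \<open>cosh (x / 2) - 1 \<ge> 0\<close>.\<close>

lemma exp_le_square_exp_minus_one:
  fixes x :: real
  assumes "0 < x"
  shows "x\<^sup>2 * exp x \<le> (exp x - 1)\<^sup>2"
proof -
  have "x \<le> exp (x/2) - exp (-(x/2))"
  proof -
    have "exp (0/2) - exp (-(0/2)) - 0 \<le> exp (x/2) - exp (-(x/2)) - x"
    proof (rule DERIV_nonneg_imp_nondecreasing[of 0 x "\<lambda>x. exp (x/2) - exp (-(x/2)) - x"])
      show "0 \<le> x" using assms by simp
      fix y :: real
      have "1 \<le> (exp (y/2) + exp (-(y/2))) / 2"
        using cosh_real_ge_1[of "y/2"] by (simp add: cosh_field_def)
      then show "\<exists>d. ((\<lambda>x. exp (x/2) - exp (-(x/2)) - x) has_real_derivative d) (at y) \<and> 0 \<le> d"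
        by (intro exI[of _ "exp (y/2) / 2 + exp (-(y/2)) / 2 - 1"]) (auto intro!: derivative_eq_intros)
    qed
    then show ?thesis by simp
  qed
  then have "x\<^sup>2 \<le> (exp (x/2) - exp (-(x/2)))\<^sup>2" using assms by (intro power_mono) auto
  then have "x\<^sup>2 * exp x \<le> (exp (x/2) - exp (-(x/2)))\<^sup>2 * exp x" by (intro mult_right_mono) auto
  also have "\<dots> = ((exp (x/2) - exp (-(x/2))) * exp (x/2))\<^sup>2"
    by (simp add: power_mult_distrib flip: exp_double)
  also have "(exp (x/2) - exp (-(x/2))) * exp (x/2) = exp x - 1"
    by (simp add: left_diff_distrib flip: exp_add)
  finally show ?thesis .
qed

text \<open>Termwise comparison of the series past the linear term with its value at
  \<open>norm w\<close> reduces the claim to the real bound \<open>exp_bound\<close>.\<close>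

lemma norm_exp_minus_linear_le:
  fixes w :: complex
  assumes "norm w \<le> 1"
  shows "norm (exp w - 1 - w) \<le> (norm w)\<^sup>2"
proof -
  have "exp w - 1 - w = (\<Sum>n. w ^ (n + 2) /\<^sub>R fact (n + 2))"
    using exp_first_two_terms[of w] by simp
  also have "norm \<dots> \<le> (\<Sum>n. norm w ^ (n + 2) / fact (n + 2))"
  proof (rule norm_suminf_le)
    show "summable (\<lambda>n. norm w ^ (n + 2) / fact (n + 2))"
      using summable_exp[of "norm w", THEN summable_ignore_initial_segment, of 2]
      by (simp add: divide_inverse mult.commute)
  qed (simp add: norm_power norm_mult divide_inverse mult_ac)
  also have "\<dots> = exp (norm w) - 1 - norm w"
    using exp_first_two_terms[of "norm w"] by (simp add: divide_inverse mult_ac)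
  also have "\<dots> \<le> (norm w)\<^sup>2" using exp_bound[of "norm w"] assms by simp
  finally show ?thesis .
qed

text \<open>The function \<^term>\<open>\<lambda>z::complex. 1 / (exp z - 1) - 1 / z\<close> is analytic at the origin; a
  derivative bound of order strictly between \<open>-3/2\<close> and \<open>-1\<close> is what makes the sum over
  multiples of \<open>t\<close> both convergent and negligible.\<close>

lemma bernoulli_deriv_bound:
  fixes w :: complex
  assumes x: "0 < Re w" and y: "\<bar>Im w\<bar> \<le> Re w"
  shows "norm (1 / w\<^sup>2 - exp w / (exp w - 1)\<^sup>2) \<le> 10 * Re w powr (-5/4)"
proof -
  define x where "x = Re w"
  have x0: "x > 0" using assms by (simp add: x_def)
  have wx: "x \<le> norm w" "norm w \<le> 2 * x"
    using complex_Re_le_cmod[of w] cmod_le[of w] assms by (auto simp: x_def)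
  have e: "x \<le> norm (exp w - 1)" "exp x - 1 \<le> norm (exp w - 1)"
    using norm_exp_minus_one_ge[OF x] by (auto simp: x_def)
  have nz: "w \<noteq> 0" "exp w - 1 \<noteq> 0" using x exp_minus_one_nonzero[OF x] by auto
  show ?thesis
  proof (cases "x \<le> 1/2")
    case True
    define r where "r = exp w - 1 - w"
    have w1: "norm w \<le> 1" using True wx by simp
    have r: "norm r \<le> (norm w)\<^sup>2" unfolding r_def by (rule norm_exp_minus_linear_le[OF w1])
    have eq: "exp w = 1 + w + r" by (simp add: r_def)
    \<comment> \<open>The second-order terms cancel. A numerator of order 3 over a denominator of
      order 4 leaves order \<open>1 / x\<close>, which is below \<open>x powr (-5/4)\<close> as
      \<open>x < 1\<close>.\<close>
    have "(exp w - 1)\<^sup>2 - w\<^sup>2 * exp w = 2 * (w * r) + r\<^sup>2 - w\<^sup>2 * w - w\<^sup>2 * r"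
      unfolding eq by (simp add: power2_eq_square algebra_simps)
    also have "norm \<dots> \<le> norm (2 * (w * r)) + norm (r\<^sup>2) + norm (w\<^sup>2 * w) + norm (w\<^sup>2 * r)"
      by (intro order_trans[OF norm_triangle_ineq4] add_mono order_refl norm_triangle_ineq)
    also have "norm (2 * (w * r)) \<le> 2 * norm w ^ 3"
      using mult_left_mono[OF r, of "norm w"] by (simp add: norm_mult power2_eq_square power3_eq_cube mult_ac)
    also have "norm (r\<^sup>2) \<le> norm w ^ 3"
    proof -
      have "norm (r\<^sup>2) \<le> ((norm w)\<^sup>2)\<^sup>2" unfolding norm_power using r by (intro power_mono) auto
      also have "\<dots> = norm w ^ 4" by (simp flip: power_mult)
      also have "\<dots> \<le> norm w ^ 3" using w1 by (intro power_decreasing) auto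
      finally show ?thesis .
    qed
    also have "norm (w\<^sup>2 * w) = norm w ^ 3" by (simp add: norm_mult norm_power power2_eq_square power3_eq_cube)
    also have "norm (w\<^sup>2 * r) \<le> norm w ^ 3"
    proof -
      have "norm (w\<^sup>2 * r) \<le> (norm w)\<^sup>2 * (norm w)\<^sup>2" unfolding norm_mult norm_power using r by (intro mult_left_mono) auto
      also have "\<dots> = norm w ^ 4" by (simp flip: power_add)
      also have "\<dots> \<le> norm w ^ 3" using w1 by (intro power_decreasing) auto
      finally show ?thesis .
    qed
    finally have num: "norm ((exp w - 1)\<^sup>2 - w\<^sup>2 * exp w) \<le> 5 * norm w ^ 3" by simp
    have "1 / w\<^sup>2 - exp w / (exp w - 1)\<^sup>2 = ((exp w - 1)\<^sup>2 - w\<^sup>2 * exp w) / (w\<^sup>2 * (exp w - 1)\<^sup>2)"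
      using nz by (simp add: diff_frac_eq mult.commute)
    also have "norm \<dots> \<le> 5 * norm w ^ 3 / ((norm w)\<^sup>2 * x\<^sup>2)"
      unfolding norm_divide norm_mult norm_power using num e x0 nz
      by (intro frac_le mult_left_mono power_mono) auto
    also have "\<dots> = 5 * norm w / x\<^sup>2" using nz by (simp add: power2_eq_square power3_eq_cube)
    also have "\<dots> \<le> 5 * (2 * x) / x\<^sup>2" using wx x0 by (intro divide_right_mono) auto
    also have "\<dots> = 10 * x powr (-1)" using x0 by (simp add: power2_eq_square powr_minus field_simps)
    also have "\<dots> \<le> 10 * x powr (-5/4)"
      using True x0 by (intro mult_left_mono powr_mono') auto
    finally show ?thesis by (simp add: x_def)
  next
    case False
    have "norm (1 / w\<^sup>2 - exp w / (exp w - 1)\<^sup>2) \<le> norm (1 / w\<^sup>2) + norm (exp w / (exp w - 1)\<^sup>2)"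
      by (rule norm_triangle_ineq4)
    also have "norm (1 / w\<^sup>2) \<le> 1 / x\<^sup>2"
      unfolding norm_divide norm_power norm_one using wx x0 nz by (intro divide_left_mono power_mono) auto
    also have "norm (exp w / (exp w - 1)\<^sup>2) \<le> exp x / (exp x - 1)\<^sup>2"
      unfolding norm_divide norm_power norm_exp_eq_Re x_def[symmetric]
      using e x0 nz by (intro divide_left_mono power_mono) auto
    also have "\<dots> \<le> 1 / x\<^sup>2"
      using exp_le_square_exp_minus_one[OF x0] x0 by (simp add: field_simps)
    finally have "norm (1 / w\<^sup>2 - exp w / (exp w - 1)\<^sup>2) \<le> 2 / x\<^sup>2" by simp
    also have "\<dots> = 2 * x powr (-3/4) * x powr (-5/4)"
    proof -
      have "x powr (-3/4) * x powr (-5/4) = x powr (-2)" by (simp flip: powr_add)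
      also have "\<dots> = 1 / x\<^sup>2" using x0 by (simp add: powr_minus powr_numeral field_simps)
      finally show ?thesis by simp
    qed
    also have "\<dots> \<le> 10 * x powr (-5/4)"
    proof (rule mult_right_mono)
      have "x powr (-3/4) \<le> (1/2) powr (-3/4)" using False by (intro powr_mono2') auto
      also have "\<dots> \<le> (1/2) powr (-1)" by (intro powr_mono') auto
      also have "\<dots> = 2" by (simp add: powr_minus)
      finally show "2 * x powr (-3/4) \<le> 10" by simp
    qed auto
    finally show ?thesis by (simp add: x_def)
  qed
qed

text \<open>Mean value inequality on a vertical segment. The real part is constant there and the
  segment stays in the sector of \<open>bernoulli_deriv_bound\<close>, so one derivative bound
  serves throughout.\<close>

lemma bernoulli_diff_bound:
  fixes w :: complex
  assumes x: "0 < Re w" and y: "\<bar>Im w\<bar> \<le> Re w"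
  shows "norm ((1 / (exp w - 1) - 1 / w) - (1 / (exp (of_real (Re w)) - 1) - 1 / of_real (Re w)))
    \<le> 10 * Re w powr (-5/4) * \<bar>Im w\<bar>"
proof -
  define S where "S = {v. Re v = Re w \<and> \<bar>Im v\<bar> \<le> Re w}"
  have "S = {v. Re v \<le> Re w} \<inter> {v. Re v \<ge> Re w} \<inter> {v. Im v \<le> Re w} \<inter> {v. Im v \<ge> - Re w}"
    unfolding S_def by auto
  then have cv: "convex S"
    by (simp only:) (intro convex_Int convex_halfspace_Re_le convex_halfspace_Re_ge
      convex_halfspace_Im_le convex_halfspace_Im_ge)
  have "norm ((\<lambda>z. 1 / (exp z - 1) - 1 / z) w - (\<lambda>z. 1 / (exp z - 1) - 1 / z) (of_real (Re w)))
      \<le> 10 * Re w powr (-5/4) * norm (w - of_real (Re w))"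
  proof (rule field_differentiable_bound[OF cv])
    fix v assume v: "v \<in> S"
    have "Re v > 0" using v x by (simp add: S_def)
    then have nz: "v \<noteq> 0" "exp v - 1 \<noteq> 0" using exp_minus_one_nonzero by auto
    show "((\<lambda>z. 1 / (exp z - 1) - 1 / z) has_field_derivative 1 / v\<^sup>2 - exp v / (exp v - 1)\<^sup>2) (at v within S)"
      using nz by (auto intro!: derivative_eq_intros simp: power2_eq_square)
    show "norm (1 / v\<^sup>2 - exp v / (exp v - 1)\<^sup>2) \<le> 10 * Re w powr (-5/4)"
      using bernoulli_deriv_bound[of v] v x by (simp add: S_def)
  qed (use x y in \<open>auto simp: S_def\<close>)
  moreover have "norm (w - of_real (Re w)) = \<bar>Im w\<bar>"
  proof -
    have "w - of_real (Re w) = \<i> * of_real (Im w)" by (simp add: complex_eq_iff)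
    then show ?thesis by (simp add: norm_mult)
  qed
  ultimately show ?thesis by simp
qed

text \<open>With \<open>z = exp (-w)\<close> the quotient \<open>z ^ m / (1 - z ^ m)\<close> is
  \<open>1 / (exp (m * w) - 1)\<close>. Subtracting its pole \<open>1 / (m * w)\<close> from every
  term removes \<open>\<zeta>(2) / w\<close> in total.\<close>

lemma partition_log_exp_expansion:
  fixes w :: complex
  assumes "0 < Re w"
  shows "(\<lambda>m. (1 / (exp (of_nat (Suc m) * w) - 1) - 1 / (of_nat (Suc m) * w)) / of_nat (Suc m)) sums
    (partition_log (exp (-w)) - of_real (pi\<^sup>2 / 6) / w)"
proof -
  define z where "z = exp (-w)"
  have z: "norm z < 1" using assms by (simp add: z_def norm_exp_eq_Re)
  have w: "w \<noteq> 0" using assms by auto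
  have "(\<lambda>m. z ^ Suc m / (of_nat (Suc m) * (1 - z ^ Suc m))) sums partition_log z"
    unfolding partition_log_def by (intro summable_sums summable_partition_log z)
  moreover have "(\<lambda>m. complex_of_real (1 / (real (m + 1))\<^sup>2) / w) sums (of_real (pi\<^sup>2 / 6) / w)"
    using inverse_squares_sums by (intro sums_divide) (simp only: sums_of_real_iff of_nat_add of_nat_1 of_nat_power)
  ultimately have "(\<lambda>m. z ^ Suc m / (of_nat (Suc m) * (1 - z ^ Suc m)) - complex_of_real (1 / (real (m + 1))\<^sup>2) / w)
      sums (partition_log z - of_real (pi\<^sup>2 / 6) / w)"
    by (rule sums_diff)
  also have "(\<lambda>m. z ^ Suc m / (of_nat (Suc m) * (1 - z ^ Suc m)) - complex_of_real (1 / (real (m + 1))\<^sup>2) / w) =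
     (\<lambda>m. (1 / (exp (of_nat (Suc m) * w) - 1) - 1 / (of_nat (Suc m) * w)) / of_nat (Suc m))"
  proof
    fix m
    define k :: complex where "k = of_nat (Suc m)"
    have k: "k \<noteq> 0" by (simp add: k_def del: of_nat_Suc)
    define E where "E = exp (k * w)"
    have "Re (k * w) > 0" using assms by (simp add: k_def)
    then have E: "E - 1 \<noteq> 0" unfolding E_def by (rule exp_minus_one_nonzero)
    have E0: "E \<noteq> 0" by (simp add: E_def)
    have zE: "z ^ Suc m = 1 / E"
      unfolding z_def E_def k_def exp_of_nat_mult[symmetric] by (simp add: exp_minus divide_inverse del: of_nat_Suc)
    have "(1 / E) / (k * (1 - 1 / E)) = 1 / (E - 1) / k"
      using E E0 k by (simp add: field_simps)
    moreover have "complex_of_real (1 / (real (m + 1))\<^sup>2) / w = 1 / (k * w) / k"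
      by (simp add: k_def power2_eq_square)
    ultimately show "z ^ Suc m / (of_nat (Suc m) * (1 - z ^ Suc m)) - complex_of_real (1 / (real (m + 1))\<^sup>2) / w =
      (1 / (exp (of_nat (Suc m) * w) - 1) - 1 / (of_nat (Suc m) * w)) / of_nat (Suc m)"
      unfolding zE k_def[symmetric] E_def[symmetric] by (simp only: diff_divide_distrib)
  qed
  finally show ?thesis by (simp add: z_def)
qed

text \<open>Apply \<open>bernoulli_diff_bound\<close> at each multiple of \<open>w\<close>. The
  multiple in the imaginary part cancels the division by \<open>Suc m\<close>, which leaves a
  convergent series with exponent \<open>-5/4\<close>; the condition
  \<open>\<bar>x\<bar> \<le> t\<close> keeps all multiples in the sector.\<close>

lemma partition_log_diff_bound:
  fixes t x :: real
  assumes t: "0 < t" and x: "\<bar>x\<bar> \<le> t"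
  shows "norm ((partition_log (exp (- Complex t (-x))) - of_real (pi\<^sup>2 / 6) / Complex t (-x)) -
       (partition_log (exp (- of_real t)) - of_real (pi\<^sup>2 / 6) / of_real t))
    \<le> 10 * (\<Sum>m. real (Suc m) powr (-5/4)) * t powr (-5/4) * \<bar>x\<bar>"
proof -
  define w where "w = Complex t (-x)"
  define f where "f v m = (1 / (exp (of_nat (Suc m) * v) - 1) - 1 / (of_nat (Suc m) * v)) / of_nat (Suc m)"
    for v :: complex and m
  have sm: "summable (\<lambda>m. real (Suc m) powr (-5/4))"
    using summable_real_powr_iff[of "-5/4"] by (subst summable_Suc_iff) simp
  have "f w sums (partition_log (exp (-w)) - of_real (pi\<^sup>2 / 6) / w)"
    "f (of_real t) sums (partition_log (exp (- of_real t)) - of_real (pi\<^sup>2 / 6) / of_real t)"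
    unfolding f_def using t by (intro partition_log_exp_expansion; simp add: w_def)+
  then have "(\<lambda>m. f w m - f (of_real t) m) sums ((partition_log (exp (-w)) - of_real (pi\<^sup>2 / 6) / w) -
      (partition_log (exp (- of_real t)) - of_real (pi\<^sup>2 / 6) / of_real t))"
    by (rule sums_diff)
  then have "(partition_log (exp (-w)) - of_real (pi\<^sup>2 / 6) / w) -
      (partition_log (exp (- of_real t)) - of_real (pi\<^sup>2 / 6) / of_real t) = (\<Sum>m. f w m - f (of_real t) m)"
    by (rule sums_unique)
  also have "norm \<dots> \<le> (\<Sum>m. 10 * t powr (-5/4) * \<bar>x\<bar> * real (Suc m) powr (-5/4))"
  proof (rule norm_suminf_le)
    fix m
    define k where "k = real (Suc m)"
    have k: "k > 0" by (simp add: k_def)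
    define v where "v = of_nat (Suc m) * w"
    have v: "Re v = k * t" "Im v = - (k * x)" by (auto simp: v_def w_def k_def)
    have "norm (f w m - f (of_real t) m) =
      norm ((1 / (exp v - 1) - 1 / v) - (1 / (exp (of_real (Re v)) - 1) - 1 / of_real (Re v))) / k"
      unfolding f_def v(1)
      by (simp add: v_def k_def norm_divide del: of_nat_Suc flip: diff_divide_distrib)
    also have "\<dots> \<le> 10 * Re v powr (-5/4) * \<bar>Im v\<bar> / k"
      using k t x by (intro divide_right_mono bernoulli_diff_bound) (auto simp: v abs_mult)
    also have "\<dots> = 10 * t powr (-5/4) * \<bar>x\<bar> * k powr (-5/4)"
      using k t by (simp add: v abs_mult powr_mult)
    finally show "norm (f w m - f (of_real t) m) \<le> 10 * t powr (-5/4) * \<bar>x\<bar> * real (Suc m) powr (-5/4)"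
      by (simp add: k_def)
  qed (intro summable_mult sm)
  also have "\<dots> = 10 * (\<Sum>m. real (Suc m) powr (-5/4)) * t powr (-5/4) * \<bar>x\<bar>"
    by (subst suminf_mult[OF sm]) (simp add: mult_ac)
  finally show ?thesis by (simp only: w_def)
qed

text \<open>Split off the polar part. The remainder is of order
  \<open>t powr (-5/4) * t powr (3/2) = t powr (1/4)\<close>. For the polar part,
  \<open>w = t * (1 - \<i> * s * sqrt t)\<close>; once the linear phase is removed it equals exactly
  \<open>- c * s\<^sup>2 / (1 - \<i> * s * sqrt t)\<close>.\<close>

lemma partition_log_gaussian_limit:
  fixes s :: real
  shows "((\<lambda>t. partition_log (of_real (exp (-t)) * cis (s * (t * sqrt t))) -
      partition_log (of_real (exp (-t))) - \<i> * of_real (pi\<^sup>2 / 6 / t\<^sup>2 * (s * (t * sqrt t))))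
    \<longlongrightarrow> of_real (- (pi\<^sup>2 / 6 * s\<^sup>2))) (at_right 0)"
proof -
  define c where "c = pi\<^sup>2 / 6"
  define Z where "Z = 10 * (\<Sum>m. real (Suc m) powr (-5/4))"
  define D where "D t = (partition_log (of_real (exp (-t)) * cis (s * (t * sqrt t))) - of_real c / Complex t (- (s * (t * sqrt t)))) -
       (partition_log (of_real (exp (-t))) - of_real c / of_real t)" for t
  have pos: "\<forall>\<^sub>F t in at_right (0::real). 0 < t" by (rule eventually_at_right_less)
  have small: "\<forall>\<^sub>F t in at_right (0::real). \<bar>s\<bar> * sqrt t < 1"
  proof (rule order_tendstoD)
    have "((\<lambda>t. \<bar>s\<bar> * sqrt t) \<longlongrightarrow> \<bar>s\<bar> * sqrt 0) (at_right 0)" by (intro tendsto_intros)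
    then show "((\<lambda>t. \<bar>s\<bar> * sqrt t) \<longlongrightarrow> 0) (at_right 0)" by simp
  qed simp
  have "(D \<longlongrightarrow> 0) (at_right 0)"
  proof (rule Lim_null_comparison)
    show "\<forall>\<^sub>F t in at_right 0. norm (D t) \<le> Z * \<bar>s\<bar> * t powr (1/4)"
      using pos small
    proof eventually_elim
      case (elim t)
      define x where "x = s * (t * sqrt t)"
      have "\<bar>x\<bar> = (\<bar>s\<bar> * sqrt t) * t" using elim by (simp add: x_def abs_mult)
      also have "\<dots> \<le> 1 * t" using elim by (intro mult_right_mono) auto
      finally have x: "\<bar>x\<bar> \<le> t" by simp
      have "exp (- Complex t (-x)) = of_real (exp (-t)) * cis x"
        by (simp add: complex_eq_iff Re_exp Im_exp)
      moreover have "exp (- of_real t) = complex_of_real (exp (-t))" using exp_of_real[of "-t"] by simp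
      ultimately have "norm (D t) \<le> Z * t powr (-5/4) * \<bar>x\<bar>"
        using partition_log_diff_bound[OF elim(1) x]
        by (simp only: D_def Z_def x_def[symmetric] c_def)
      also have "\<bar>x\<bar> = \<bar>s\<bar> * t powr (3/2)"
      proof -
        have "t * sqrt t = t powr 1 * t powr (1/2)" using elim by (simp add: powr_half_sqrt)
        also have "\<dots> = t powr (3/2)" by (simp only: powr_add[symmetric]) simp
        finally have e: "t * sqrt t = t powr (3/2)" .
        show ?thesis unfolding x_def e by (simp add: abs_mult)
      qed
      also have "Z * t powr (-5/4) * (\<bar>s\<bar> * t powr (3/2)) = Z * \<bar>s\<bar> * (t powr (-5/4) * t powr (3/2))"
        by simp
      also have "t powr (-5/4) * t powr (3/2) = t powr (1/4)" by (simp flip: powr_add)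
      finally show ?case .
    qed
    have "((\<lambda>t. Z * \<bar>s\<bar> * t powr (1/4)) \<longlongrightarrow> Z * \<bar>s\<bar> * 0 powr (1/4)) (at_right 0)"
      by (intro tendsto_mult tendsto_const tendsto_powr2 tendsto_ident_at pos[THEN eventually_mono]) auto
    then show "((\<lambda>t. Z * \<bar>s\<bar> * t powr (1/4)) \<longlongrightarrow> 0) (at_right 0)" by simp
  qed
  moreover have "((\<lambda>t. - (of_real (c * s\<^sup>2) / (1 - \<i> * of_real (s * sqrt t)))) \<longlongrightarrow>
      - (of_real (c * s\<^sup>2) / (1 - \<i> * of_real (s * sqrt 0)))) (at_right 0)"
    by (intro tendsto_intros) auto
  ultimately have "((\<lambda>t. D t + - (of_real (c * s\<^sup>2) / (1 - \<i> * of_real (s * sqrt t)))) \<longlongrightarrow>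
      0 + - (of_real (c * s\<^sup>2) / (1 - \<i> * of_real (s * sqrt 0)))) (at_right 0)"
    by (rule tendsto_add)
  then have lim: "((\<lambda>t. D t + - (of_real (c * s\<^sup>2) / (1 - \<i> * of_real (s * sqrt t)))) \<longlongrightarrow>
      of_real (- (c * s\<^sup>2))) (at_right 0)" by simp
  have "((\<lambda>t. partition_log (of_real (exp (-t)) * cis (s * (t * sqrt t))) -
      partition_log (of_real (exp (-t))) - \<i> * of_real (c / t\<^sup>2 * (s * (t * sqrt t))))
    \<longlongrightarrow> of_real (- (c * s\<^sup>2))) (at_right 0)"
  proof (rule Lim_transform_eventually[OF lim])
    show "\<forall>\<^sub>F t in at_right 0. D t + - (of_real (c * s\<^sup>2) / (1 - \<i> * of_real (s * sqrt t))) =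
      partition_log (of_real (exp (-t)) * cis (s * (t * sqrt t))) -
      partition_log (of_real (exp (-t))) - \<i> * of_real (c / t\<^sup>2 * (s * (t * sqrt t)))"
      using pos
    proof eventually_elim
      case (elim t)
      \<comment> \<open>In terms of the square root \<open>r\<close> of \<open>t\<close> the
        identity for the polar part becomes a rational one, with
        \<open>w = r * r * u\<close>.\<close>
      define r where "r = complex_of_real (sqrt t)"
      have r2: "complex_of_real t = r * r" using elim by (simp add: r_def flip: of_real_mult)
      have r: "r \<noteq> 0" using elim by (simp add: r_def)
      define u where "u = 1 - \<i> * (of_real s * r)"
      have "Re u = 1" by (simp add: u_def r_def)
      then have u: "u \<noteq> 0" by auto
      have w: "Complex t (- (s * (t * sqrt t))) = r * r * u"
        unfolding u_def r2[symmetric] by (simp add: r_def complex_eq_iff)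
      define C S where "C = complex_of_real c" and "S = complex_of_real s"
      have uS: "u - 1 = - (\<i> * S * r)" by (simp add: u_def S_def)
      have "C / (r * r) - C / (r * r * u) = C * (u - 1) / (r * r * u)"
        using r u by (simp add: field_simps)
      also have "\<dots> = - (\<i> * C * S / (r * u))"
        unfolding uS using r u by (simp add: field_simps)
      finally have 1: "C / (r * r) - C / (r * r * u) = - (\<i> * C * S / (r * u))" .
      have "\<i> * C * S / (r * u) + C * (S * S) / u = \<i> * C * S * (1 - \<i> * S * r) / (r * u)"
        using r u by (simp add: field_simps)
      also have "1 - \<i> * S * r = u" by (simp add: u_def S_def)
      also have "\<i> * C * S * u / (r * u) = \<i> * C * S / r" using u by simp
      finally have 2: "\<i> * C * S / (r * u) + C * (S * S) / u = \<i> * C * S / r" .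
      have 3: "\<i> * of_real (c / t\<^sup>2 * (s * (t * sqrt t))) = \<i> * C * S / r"
      proof -
        have "\<i> * of_real (c / t\<^sup>2 * (s * (t * sqrt t))) = \<i> * (C / (r * r * (r * r)) * (S * (r * r * r)))"
          by (simp only: of_real_mult of_real_divide of_real_power power2_eq_square
              r2 r_def[symmetric] C_def S_def)
        then show ?thesis using r by simp
      qed
      have 4: "of_real (c * s\<^sup>2) / (1 - \<i> * of_real (s * sqrt t)) = C * (S * S) / u"
        by (simp add: C_def S_def u_def r_def power2_eq_square)
      have 5: "C / of_real t = C / (r * r)" by (simp only: r2)
      have 6: "\<i> * C * S / r = C * (S * S) / u - (C / (r * r) - C / (r * r * u))"
        unfolding 1 2[symmetric] by simp
      show ?case
        unfolding D_def w 3 4 C_def[symmetric] 5 6 by simp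
    qed
  qed
  then show ?thesis by (simp only: c_def)
qed

subsection \<open>Dominated convergence\<close>

lemma integrable_inverse_1_plus_square_UNIV:
  "(\<lambda>x::real. inverse (1 + x\<^sup>2)) integrable_on UNIV"
  using integrable_inverse_1_plus_square
  by (auto dest!: set_borel_integral_eq_integral(1) simp: einterval_def)

text \<open>Serves to show that the limiting integral is nonzero; its exact value cancels in the
  final quotient.\<close>

lemma integral_UNIV_pos:
  fixes f :: "real \<Rightarrow> real"
  assumes "f integrable_on UNIV" "\<And>x. 0 \<le> f x" "0 < d" "\<And>x. 0 \<le> x \<Longrightarrow> x \<le> 1 \<Longrightarrow> d \<le> f x"
  shows "0 < integral UNIV f"
proof -
  have i: "f integrable_on {0..1}"
    using integrable_on_subinterval[of f UNIV 0 1] assms(1) by simp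
  have "d = integral {0..1::real} (\<lambda>_. d)" by simp
  also have "\<dots> \<le> integral {0..1} f" using i assms(4) by (intro integral_le) auto
  also have "\<dots> \<le> integral UNIV f" using assms i by (intro integral_subset_le) auto
  finally show ?thesis using assms(3) by simp
qed

text \<open>The minimiser over \<open>t > 0\<close> of \<open>\<zeta>(2) / t + n * t\<close>, the
  leading part of the exponent in \<open>P (exp (-t)) * exp (n * t)\<close>.\<close>

definition saddle :: "nat \<Rightarrow> real" where
  "saddle n = sqrt (pi\<^sup>2 / 6 / real n)"

text \<open>The coefficient integrand divided by its value at the positive real point of the circle,
  hence equal to 1 at \<open>x = 0\<close>.\<close>

definition saddle_kernel :: "nat \<Rightarrow> real \<Rightarrow> complex" where
  "saddle_kernel n x =
     exp (partition_log (of_real (exp (- saddle n)) * cis x) - partition_log (of_real (exp (- saddle n)))) *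
     cis (- (real n * x))"

lemma saddle_pos: "0 < n \<Longrightarrow> 0 < saddle n"
  by (simp add: saddle_def)

lemma saddle_square: "0 < n \<Longrightarrow> real n = pi\<^sup>2 / 6 / (saddle n)\<^sup>2"
  by (simp add: saddle_def)

lemma saddle_tendsto: "filterlim saddle (at_right 0) sequentially"
proof (rule tendsto_imp_filterlim_at_right)
  have "(\<lambda>n. sqrt (pi\<^sup>2 / 6 / real n)) \<longlonglongrightarrow> sqrt 0"
    by (intro tendsto_real_sqrt tendsto_divide_0[OF tendsto_const] filterlim_real_sequentially
        filterlim_at_top_imp_at_infinity)
  then show "saddle \<longlonglongrightarrow> 0" unfolding saddle_def by simp
  show "\<forall>\<^sub>F n in sequentially. 0 < saddle n"
    using eventually_gt_at_top[of 0] by eventually_elim (rule saddle_pos)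
qed

text \<open>With the crude bound \<open>pi < 4\<close>, the value 11 is the first that works: 16/66
  is below 1/4 while 16/60 is not.\<close>

lemma saddle_le_half: "11 \<le> n \<Longrightarrow> saddle n \<le> 1/2"
proof -
  assume n: "11 \<le> n"
  have "pi\<^sup>2 \<le> 4\<^sup>2" using pi_less_4 by (intro power_mono) auto
  then have "pi\<^sup>2 / 6 / real n \<le> (1/2)\<^sup>2" using n by (simp add: field_simps power2_eq_square)
  then show ?thesis unfolding saddle_def by (intro real_le_lsqrt) auto
qed

text \<open>Both integrals carry the same factor \<open>a\<close>, which will cancel. For the
  second, lowering \<open>n\<close> by one multiplies the integrand by \<open>z\<close>, and the two
  counts are subtracted.\<close>

lemma saddle_kernel_has_integral:
  fixes n :: nat
  assumes n: "0 < n"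
  defines "q \<equiv> exp (- saddle n)"
  defines "a \<equiv> of_real (2 * pi * q ^ n) * exp (- partition_log (of_real q))"
  shows "(saddle_kernel n has_integral a * of_real (real (part_count n))) {-pi..pi}"
    and "((\<lambda>x. saddle_kernel n x * (1 - of_real q * cis x)) has_integral
      a * of_real (real (nonunitary_part_count n))) {-pi..pi}"
proof -
  define z where "z x = complex_of_real q * cis x" for x
  have q: "0 < q" "q < 1" using saddle_pos[OF n] by (auto simp: q_def)
  define b where "b = of_real (q ^ n) * exp (- partition_log (of_real q))"
  have zn: "z x powi (- int n) * of_real (q ^ n) = cis (- (real n * x))" for x
  proof -
    have "z x powi (- int n) = inverse (of_real (q ^ n) * cis (real n * x))"
      by (simp add: power_int_minus z_def power_mult_distrib Complex.DeMoivre)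
    then show ?thesis using q by (simp add: cis_inverse flip: cis_inverse)
  qed
  have K: "b * (exp (partition_log (z x)) * z x powi (- int n)) = saddle_kernel n x" for x
    unfolding saddle_kernel_def q_def[symmetric] z_def[symmetric] zn[symmetric] b_def
    by (simp add: exp_diff exp_minus divide_inverse mult_ac)
  have "((\<lambda>x. b * (exp (partition_log (z x)) * z x powi (- int n))) has_integral
      b * of_real (2 * pi * real (part_count n))) {-pi..pi}"
    unfolding z_def by (intro has_integral_mult_right part_count_has_integral q)
  also have "b * of_real (2 * pi * real (part_count n)) = a * of_real (real (part_count n))"
    by (simp add: b_def a_def)
  finally show 1: "(saddle_kernel n has_integral a * of_real (real (part_count n))) {-pi..pi}"
    unfolding K .
  have "((\<lambda>x. b * (exp (partition_log (z x)) * z x powi (- int (n - 1)))) has_integral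
      b * of_real (2 * pi * real (part_count (n - 1)))) {-pi..pi}"
    unfolding z_def by (intro has_integral_mult_right part_count_has_integral q)
  also have "(\<lambda>x. b * (exp (partition_log (z x)) * z x powi (- int (n - 1)))) = (\<lambda>x. saddle_kernel n x * z x)"
  proof
    fix x
    have "z x \<noteq> 0" using q by (simp add: z_def)
    then have "z x powi (- int (n - 1)) = z x powi (- int n) * z x"
      using n power_int_add_1[of "z x" "- int n"] by (simp add: of_nat_diff algebra_simps)
    then show "b * (exp (partition_log (z x)) * z x powi (- int (n - 1))) = saddle_kernel n x * z x"
      unfolding K[symmetric] by simp
  qed
  finally have 2: "((\<lambda>x. saddle_kernel n x * z x) has_integral b * of_real (2 * pi * real (part_count (n - 1)))) {-pi..pi}" .
  have "((\<lambda>x. saddle_kernel n x - saddle_kernel n x * z x) has_integral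
     a * of_real (real (part_count n)) - b * of_real (2 * pi * real (part_count (n - 1)))) {-pi..pi}"
    by (rule has_integral_diff[OF 1 2])
  moreover have "a * of_real (real (part_count n)) - b * of_real (2 * pi * real (part_count (n - 1))) =
      a * of_real (real (nonunitary_part_count n))"
    using part_count_Suc[of "n - 1"] n by (simp add: a_def b_def algebra_simps)
  ultimately show "((\<lambda>x. saddle_kernel n x * (1 - of_real q * cis x)) has_integral
      a * of_real (real (nonunitary_part_count n))) {-pi..pi}"
    by (simp add: z_def right_diff_distrib)
qed

text \<open>As \<open>n = \<zeta>(2) / t\<^sup>2\<close> at the saddle, the phase
  \<open>n * x\<close> is precisely the linear term subtracted in
  \<open>partition_log_gaussian_limit\<close>.\<close>

lemma saddle_kernel_pointwise:
  "(\<lambda>n. saddle_kernel n (saddle n * sqrt (saddle n) * s)) \<longlonglongrightarrow> of_real (exp (- (pi\<^sup>2 / 6 * s\<^sup>2)))"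
proof -
  let ?g = "\<lambda>t. partition_log (of_real (exp (-t)) * cis (s * (t * sqrt t))) -
      partition_log (of_real (exp (-t))) - \<i> * of_real (pi\<^sup>2 / 6 / t\<^sup>2 * (s * (t * sqrt t)))"
  have "(\<lambda>n. exp (?g (saddle n))) \<longlonglongrightarrow> exp (of_real (- (pi\<^sup>2 / 6 * s\<^sup>2)))"
    by (intro tendsto_exp filterlim_compose[OF partition_log_gaussian_limit saddle_tendsto])
  moreover have "\<forall>\<^sub>F n in sequentially. exp (?g (saddle n)) = saddle_kernel n (saddle n * sqrt (saddle n) * s)"
    using eventually_gt_at_top[of 0]
  proof eventually_elim
    case (elim n)
    show ?case
      unfolding saddle_square[OF elim, symmetric] saddle_kernel_def
      by (simp add: exp_diff cis_conv_exp exp_minus divide_inverse mult_ac)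
  qed
  ultimately show ?thesis
    by (simp add: exp_of_real[symmetric] Lim_transform_eventually)
qed

lemma saddle_kernel_bound:
  assumes n: "11 \<le> n" and s: "\<bar>saddle n * sqrt (saddle n) * s\<bar> \<le> pi"
  shows "(1 + \<bar>s\<bar>) * norm (saddle_kernel n (saddle n * sqrt (saddle n) * s)) \<le>
    (4 + 4 * (6 ^ 6 * 64 * (pi ^ 12 + 64 * pi ^ 4))) * inverse (1 + s\<^sup>2)"
proof -
  define t where "t = saddle n"
  define x where "x = t * sqrt t * s"
  have t: "0 < t" "t \<le> 1/2" using n saddle_pos[of n] saddle_le_half[of n] by (auto simp: t_def)
  have x2: "x\<^sup>2 = t * t\<^sup>2 * s\<^sup>2" using t by (simp add: x_def power_mult_distrib)
  have "norm (saddle_kernel n x) \<le> exp (- (x\<^sup>2 / (t * (pi\<^sup>2 * t\<^sup>2 + 2 * x\<^sup>2))))"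
    unfolding saddle_kernel_def t_def[symmetric] norm_mult norm_cis mult_1_right
    using s t by (intro norm_partition_ratio_le) (auto simp: x_def t_def)
  also have "x\<^sup>2 / (t * (pi\<^sup>2 * t\<^sup>2 + 2 * x\<^sup>2)) = s\<^sup>2 / (pi\<^sup>2 + 2 * s\<^sup>2 * t)"
  proof -
    have "t * (pi\<^sup>2 * t\<^sup>2 + 2 * x\<^sup>2) = (t * t\<^sup>2) * (pi\<^sup>2 + 2 * s\<^sup>2 * t)"
      unfolding x2 by (simp add: algebra_simps)
    then show ?thesis using t unfolding x2 by simp
  qed
  finally have "(1 + \<bar>s\<bar>) * norm (saddle_kernel n x) \<le> (1 + \<bar>s\<bar>) * exp (- (s\<^sup>2 / (pi\<^sup>2 + 2 * s\<^sup>2 * t)))"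
    by (intro mult_left_mono) auto
  also have "\<dots> \<le> (4 + 4 * (6 ^ 6 * 64 * (pi ^ 12 + 64 * pi ^ 4))) * inverse (1 + s\<^sup>2)"
    using s t by (intro gaussian_decay_bound) (auto simp: t_def abs_mult mult_ac)
  finally show ?thesis by (simp only: x_def t_def)
qed

text \<open>The weight \<open>u\<close> lets one argument serve both counts: \<open>u = 1\<close>
  for all partitions and \<open>u = (1 - z) / t\<close> for the non-unitary ones. The substitution
  \<open>x = \<tau> n * s\<close> stretches the circle to intervals that exhaust the real
  line.\<close>

lemma saddle_integral_limit:
  fixes u :: "nat \<Rightarrow> real \<Rightarrow> complex" and I :: "nat \<Rightarrow> complex"
  defines "\<tau> \<equiv> \<lambda>n. saddle n * sqrt (saddle n)"
  assumes int: "\<And>n. 0 < n \<Longrightarrow> ((\<lambda>x. saddle_kernel n x * u n x) has_integral I n) {-pi..pi}"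
    and bound: "\<And>n s. 11 \<le> n \<Longrightarrow> norm (u n (\<tau> n * s)) \<le> 1 + \<bar>s\<bar>"
    and lim: "\<And>s. (\<lambda>n. u n (\<tau> n * s)) \<longlonglongrightarrow> 1"
  shows "(\<lambda>n. I n / of_real (\<tau> n)) \<longlonglongrightarrow> integral UNIV (\<lambda>s. complex_of_real (exp (- (pi\<^sup>2 / 6 * s\<^sup>2))))"
    and "(\<lambda>s. complex_of_real (exp (- (pi\<^sup>2 / 6 * s\<^sup>2)))) integrable_on UNIV"
proof -
  define K :: real where "K = 4 + 4 * (6 ^ 6 * 64 * (pi ^ 12 + 64 * pi ^ 4))"
  have K: "K \<ge> 0" by (simp add: K_def)
  define S where "S n = {- (pi / \<tau> n)..pi / \<tau> n}" for n
  define f where "f n s = (if s \<in> S n then saddle_kernel n (\<tau> n * s) * u n (\<tau> n * s) else 0)" for n s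
  have \<tau>: "0 < \<tau> n" if "0 < n" for n using saddle_pos[OF that] by (simp add: \<tau>_def)
  have f_int: "(f n has_integral I n / of_real (\<tau> n)) UNIV" if "0 < n" for n
  proof -
    have "(\<lambda>x. x / \<tau> n) ` {-pi..pi} = S n"
    proof -
      have "(\<lambda>x. x / \<tau> n) ` {-pi..pi} = {-pi / \<tau> n..pi / \<tau> n}"
        using \<tau>[OF that] image_divide_atLeastAtMost[of "\<tau> n" "-pi" pi] by simp
      then show ?thesis by (simp add: S_def)
    qed
    then have "((\<lambda>s. saddle_kernel n (\<tau> n * s) * u n (\<tau> n * s)) has_integral (1 / \<bar>\<tau> n\<bar>) *\<^sub>R I n) (S n)"
      using has_integral_stretch_real[OF int[OF that], of "\<tau> n"] \<tau>[OF that] by simp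
    moreover have "(1 / \<bar>\<tau> n\<bar>) *\<^sub>R I n = I n / of_real (\<tau> n)"
      using \<tau>[OF that] by (simp add: scaleR_conv_of_real)
    ultimately show ?thesis
      unfolding f_def by (subst has_integral_restrict_UNIV) simp
  qed
  have f_bound: "norm (f n s) \<le> K * inverse (1 + s\<^sup>2)" if "11 \<le> n" for n s
  proof (cases "s \<in> S n")
    case True
    have "\<bar>s\<bar> \<le> pi / \<tau> n" using True by (auto simp: S_def)
    then have s: "\<bar>\<tau> n * s\<bar> \<le> pi" using \<tau>[of n] that by (simp add: abs_mult field_simps)
    have "norm (f n s) \<le> norm (saddle_kernel n (\<tau> n * s)) * (1 + \<bar>s\<bar>)"
      using True bound[OF that, of s] by (simp add: f_def norm_mult mult_left_mono)
    also have "\<dots> \<le> K * inverse (1 + s\<^sup>2)"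
      using saddle_kernel_bound[OF that, of s] s by (simp add: \<tau>_def K_def mult.commute)
    finally show ?thesis .
  next
    case False
    then show ?thesis using K by (simp add: f_def add_nonneg_nonneg)
  qed
  have f_lim: "(\<lambda>n. f n s) \<longlonglongrightarrow> of_real (exp (- (pi\<^sup>2 / 6 * s\<^sup>2)))" for s
  proof -
    have "(\<lambda>n. saddle_kernel n (\<tau> n * s) * u n (\<tau> n * s)) \<longlonglongrightarrow> of_real (exp (- (pi\<^sup>2 / 6 * s\<^sup>2))) * 1"
      by (intro tendsto_mult lim) (simp only: \<tau>_def saddle_kernel_pointwise)
    moreover have "\<forall>\<^sub>F n in sequentially. saddle_kernel n (\<tau> n * s) * u n (\<tau> n * s) = f n s"
    proof -
      have "((\<lambda>t. \<bar>s\<bar> * (t * sqrt t)) \<longlongrightarrow> \<bar>s\<bar> * (0 * sqrt 0)) (at_right 0)" by (intro tendsto_intros)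
      then have "(\<lambda>n. \<bar>s\<bar> * \<tau> n) \<longlonglongrightarrow> 0"
        unfolding \<tau>_def using filterlim_compose[OF _ saddle_tendsto] by fastforce
      then have "\<forall>\<^sub>F n in sequentially. \<bar>s\<bar> * \<tau> n < pi" by (rule order_tendstoD) auto
      then show ?thesis using eventually_gt_at_top[of 0]
      proof eventually_elim
        case (elim n)
        then have "\<bar>s\<bar> \<le> pi / \<tau> n" using \<tau>[of n] by (simp add: field_simps)
        then show ?case by (auto simp: f_def S_def)
      qed
    qed
    ultimately show ?thesis by (simp add: Lim_transform_eventually)
  qed
  let ?g = "\<lambda>s. complex_of_real (exp (- (pi\<^sup>2 / 6 * s\<^sup>2)))"
  \<comment> \<open>The sequence is shifted by 11 because the majorant holds only from there
    on.\<close>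
  have dc: "?g integrable_on UNIV \<and> (\<lambda>n. integral UNIV (f (n + 11))) \<longlonglongrightarrow> integral UNIV ?g"
  proof (intro conjI; rule dominated_convergence[where h = "\<lambda>s. K * inverse (1 + s\<^sup>2)"])
    show "f (n + 11) integrable_on UNIV" "f (n + 11) integrable_on UNIV" for n
      using f_int[of "n + 11"] by (auto simp: integrable_on_def)
    show "(\<lambda>s. K * inverse (1 + s\<^sup>2)) integrable_on UNIV" "(\<lambda>s. K * inverse (1 + s\<^sup>2)) integrable_on UNIV"
      by (intro integrable_on_mult_right integrable_inverse_1_plus_square_UNIV)+
    show "norm (f (n + 11) s) \<le> K * inverse (1 + s\<^sup>2)" "norm (f (n + 11) s) \<le> K * inverse (1 + s\<^sup>2)" for n s
      by (intro f_bound; simp)+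
    show "(\<lambda>n. f (n + 11) s) \<longlonglongrightarrow> ?g s" "(\<lambda>n. f (n + 11) s) \<longlonglongrightarrow> ?g s" for s
      by (intro LIMSEQ_ignore_initial_segment f_lim)+
  qed
  then show "?g integrable_on UNIV" by simp
  have "(\<lambda>n. integral UNIV (f (n + 11))) = (\<lambda>n. I (n + 11) / of_real (\<tau> (n + 11)))"
    using f_int by (intro ext integral_unique) simp
  then have "(\<lambda>n. I (n + 11) / of_real (\<tau> (n + 11))) \<longlonglongrightarrow> integral UNIV ?g"
    using dc by metis
  then show "(\<lambda>n. I n / of_real (\<tau> n)) \<longlonglongrightarrow> integral UNIV ?g"
    by (rule LIMSEQ_offset)
qed

section \<open>The factor \<open>1 - z\<close> on the scale of the saddle point\<close>

lemma norm_one_minus_exp_cis_le: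
  assumes "0 \<le> t"
  shows "norm (1 - of_real (exp (-t)) * cis x) \<le> t + \<bar>x\<bar>"
proof -
  have "norm (1 - of_real (exp (-t)) * cis x) =
      norm (of_real (1 - exp (-t)) + of_real (exp (-t)) * (1 - cis x))"
    by (simp add: algebra_simps)
  also have "\<dots> \<le> \<bar>1 - exp (-t)\<bar> + exp (-t) * norm (1 - cis x)"
    using norm_triangle_ineq[of "of_real (1 - exp (-t))" "of_real (exp (-t)) * (1 - cis x)"]
    by (simp only: norm_mult norm_of_real abs_exp_cancel)
  also have "\<dots> \<le> t + 1 * \<bar>x\<bar>"
  proof (intro add_mono mult_mono)
    show "\<bar>1 - exp (-t)\<bar> \<le> t" using exp_ge_add_one_self[of "-t"] assms by simp
    have "norm (1 - cis x) = 2 * \<bar>sin (x / 2)\<bar>"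
      using dist_exp_i_1[of x] by (simp add: cis_conv_exp norm_minus_commute)
    then show "norm (1 - cis x) \<le> \<bar>x\<bar>" using abs_sin_x_le_abs_x[of "x / 2"] by simp
  qed (use assms in auto)
  finally show ?thesis by simp
qed

text \<open>With \<open>z = exp (-w)\<close> and \<open>w = t * (1 - \<i> * s * sqrt t)\<close>, the
  quotient is the difference quotient of \<open>exp\<close> at 0 times \<open>w / t\<close>, and
  both factors tend to 1.\<close>

lemma one_minus_exp_cis_limit:
  "((\<lambda>t. (1 - of_real (exp (-t)) * cis (t * sqrt t * s)) / of_real t) \<longlongrightarrow> 1) (at_right 0)"
proof -
  define w where "w t = of_real t * (1 - \<i> * of_real (s * sqrt t))" for t
  have pos: "\<forall>\<^sub>F t in at_right (0::real). 0 < t" by (rule eventually_at_right_less)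
  have "((\<lambda>z. (exp (0 + z) - exp 0) / z) \<longlongrightarrow> exp 0) (at (0::complex))"
    using DERIV_exp[of 0] unfolding DERIV_def by simp
  then have d: "((\<lambda>z::complex. (exp z - 1) / z) \<longlongrightarrow> 1) (at 0)" by simp
  have w0: "filterlim (\<lambda>t. - w t) (at 0) (at_right 0)"
  proof (rule filterlim_atI)
    have "((\<lambda>t. - w t) \<longlongrightarrow> - (of_real 0 * (1 - \<i> * of_real (s * sqrt 0)))) (at_right 0)"
      unfolding w_def by (intro tendsto_intros)
    then show "((\<lambda>t. - w t) \<longlongrightarrow> 0) (at_right 0)" by simp
    show "\<forall>\<^sub>F t in at_right 0. - w t \<noteq> 0"
      using pos by eventually_elim (auto simp: w_def complex_eq_iff)
  qed
  have "((\<lambda>t. (exp (- w t) - 1) / (- w t) * (1 - \<i> * of_real (s * sqrt t))) \<longlongrightarrow>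
      1 * (1 - \<i> * of_real (s * sqrt 0))) (at_right 0)"
    by (intro tendsto_intros filterlim_compose[OF d w0])
  then have lim: "((\<lambda>t. (exp (- w t) - 1) / (- w t) * (1 - \<i> * of_real (s * sqrt t))) \<longlongrightarrow> 1) (at_right 0)"
    by simp
  show ?thesis
  proof (rule Lim_transform_eventually[OF lim])
    show "\<forall>\<^sub>F t in at_right 0. (exp (- w t) - 1) / (- w t) * (1 - \<i> * of_real (s * sqrt t)) =
        (1 - of_real (exp (-t)) * cis (t * sqrt t * s)) / of_real t"
      using pos
    proof eventually_elim
      case (elim t)
      define u where "u = 1 - \<i> * complex_of_real (s * sqrt t)"
      have "Re u = 1" by (simp add: u_def)
      then have u: "u \<noteq> 0" by auto
      have "exp (- w t) = of_real (exp (-t)) * cis (t * sqrt t * s)"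
        by (simp add: w_def complex_eq_iff Re_exp Im_exp mult_ac)
      moreover have "w t = of_real t * u" by (simp add: w_def u_def)
      ultimately show ?case using u elim unfolding u_def[symmetric] by (simp add: field_simps)
    qed
  qed
qed

section \<open>Comparison of the two normalised integrals\<close>

theorem theorem1:
  shows "(\<lambda>n. real (part_count n)) \<sim>[at_top]
         (\<lambda>n. real (nonunitary_part_count n) * sqrt (real n / (pi^2 / 6)))"
proof (rule asymp_equivI')
  define \<tau> where "\<tau> n = saddle n * sqrt (saddle n)" for n
  define q where "q n = exp (- saddle n)" for n
  define a where "a n = of_real (2 * pi * q n ^ n) * exp (- partition_log (of_real (q n)))" for n
  define g where "g s = exp (- (pi\<^sup>2 / 6 * s\<^sup>2))" for s
  define J where "J = integral UNIV (\<lambda>s. complex_of_real (g s))"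
  note simps = \<tau>_def[symmetric] q_def[symmetric] a_def[symmetric] g_def[symmetric]
  have P: "(\<lambda>n. a n * of_real (real (part_count n)) / of_real (\<tau> n)) \<longlonglongrightarrow> J"
    and g_int: "(\<lambda>s. complex_of_real (g s)) integrable_on UNIV"
    using saddle_integral_limit[of "\<lambda>_ _. 1" "\<lambda>n. a n * of_real (real (part_count n))"]
      saddle_kernel_has_integral(1)
    unfolding simps J_def by auto
  have N: "(\<lambda>n. (a n * of_real (real (nonunitary_part_count n)) / of_real (saddle n)) / of_real (\<tau> n)) \<longlonglongrightarrow> J"
    unfolding J_def g_def \<tau>_def
  proof (rule saddle_integral_limit(1)[where u = "\<lambda>n x. (1 - of_real (q n) * cis x) / of_real (saddle n)"])
    fix n :: nat assume "0 < n"
    from has_integral_divide[OF saddle_kernel_has_integral(2)[OF this], of "of_real (saddle n)"]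
    show "((\<lambda>x. saddle_kernel n x * ((1 - of_real (q n) * cis x) / of_real (saddle n))) has_integral
       a n * of_real (real (nonunitary_part_count n)) / of_real (saddle n)) {-pi..pi}"
      by (simp only: simps times_divide_eq_right)
  next
    fix n :: nat and s :: real assume n: "11 \<le> n"
    have t: "0 < saddle n" "saddle n \<le> 1/2" using n saddle_pos[of n] saddle_le_half[of n] by auto
    then have "sqrt (saddle n) \<le> 1" by (simp add: real_sqrt_le_1_iff)
    \<comment> \<open>Since \<open>sqrt t \<le> 1\<close>, the angle is at most
      \<open>t * \<bar>s\<bar>\<close>, so dividing \<open>1 - z\<close> by \<open>t\<close> leaves
      the weight \<open>1 + \<bar>s\<bar>\<close>.\<close>
    then have "\<tau> n * \<bar>s\<bar> \<le> saddle n * \<bar>s\<bar>" unfolding \<tau>_def using t by (intro mult_right_mono) (auto simp: mult_left_le)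
    then have "norm (1 - of_real (q n) * cis (\<tau> n * s)) \<le> saddle n * (1 + \<bar>s\<bar>)"
      using norm_one_minus_exp_cis_le[of "saddle n" "\<tau> n * s"] t
      by (simp add: q_def abs_mult \<tau>_def algebra_simps)
    then show "norm ((1 - of_real (q n) * cis (saddle n * sqrt (saddle n) * s)) / of_real (saddle n)) \<le> 1 + \<bar>s\<bar>"
      using t by (simp add: norm_divide \<tau>_def field_simps)
  next
    show "(\<lambda>n. (1 - of_real (q n) * cis (saddle n * sqrt (saddle n) * s)) / of_real (saddle n)) \<longlonglongrightarrow> 1" for s
      unfolding q_def by (rule filterlim_compose[OF one_minus_exp_cis_limit saddle_tendsto])
  qed
  have J: "J \<noteq> 0"
  proof -
    have gi: "g integrable_on UNIV" using integrable_linear[OF g_int bounded_linear_Re] by (simp add: o_def)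
    have "0 < integral UNIV g"
    proof (rule integral_UNIV_pos[OF gi])
      show "exp (- (pi\<^sup>2 / 6)) \<le> g x" if "0 \<le> x" "x \<le> 1" for x
        using that by (simp add: g_def power_le_one mult_left_le)
    qed (auto simp: g_def)
    moreover have "J = of_real (integral UNIV g)"
      unfolding J_def using integral_linear[OF gi bounded_linear_of_real] by (simp add: o_def)
    ultimately show ?thesis by simp
  qed
  \<comment> \<open>Dividing the limits cancels \<open>a n\<close> and \<open>\<tau> n\<close>, so
    the size of \<open>a n\<close> is never estimated. What remains is \<open>saddle n\<close> times
    the quotient of the counts, and \<open>1 / saddle n\<close> is the square root in the
    claim.\<close>
  have "(\<lambda>n. (a n * of_real (real (part_count n)) / of_real (\<tau> n)) /
      ((a n * of_real (real (nonunitary_part_count n)) / of_real (saddle n)) / of_real (\<tau> n))) \<longlonglongrightarrow> J / J"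
    by (intro tendsto_divide P N J)
  moreover have "\<forall>\<^sub>F n in sequentially. (a n * of_real (real (part_count n)) / of_real (\<tau> n)) /
      ((a n * of_real (real (nonunitary_part_count n)) / of_real (saddle n)) / of_real (\<tau> n)) =
      complex_of_real (real (part_count n) / (real (nonunitary_part_count n) * sqrt (real n / (pi^2 / 6))))"
    using eventually_gt_at_top[of 0]
  proof eventually_elim
    case (elim n)
    have t: "saddle n > 0" using saddle_pos[OF elim] .
    then have "\<tau> n \<noteq> 0" "a n \<noteq> 0" by (auto simp: \<tau>_def a_def q_def)
    moreover have "sqrt (real n / (pi^2 / 6)) = 1 / saddle n"
      by (simp add: saddle_def real_sqrt_divide)
    ultimately show ?case using t by simp
  qed
  ultimately have "(\<lambda>n. complex_of_real (real (part_count n) / (real (nonunitary_part_count n) * sqrt (real n / (pi^2 / 6)))))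
      \<longlonglongrightarrow> of_real 1"
    using J by (simp add: Lim_transform_eventually)
  then show "(\<lambda>n. real (part_count n) / (real (nonunitary_part_count n) * sqrt (real n / (pi^2 / 6)))) \<longlonglongrightarrow> 1"
    by (simp only: tendsto_of_real_iff)
qed

end
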